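(* Let $e,n$ be positive integers and let $g\in P_G$. The Hurwitz action is transitive on $\mathrm{Red}_T(g)$.
   Context: $\mu_e\subset\mathbb{C}$ is the group of $e$-th roots of unity and $\zeta_e=\exp(2i\pi/e)$. $G(e,e,n+1)\subset GL_{n+1}(\mathbb{C})$ is the group generated by the permutation matrices and the diagonal matrices with entries in $\mu_e$ and determinant $1$. $T$ is the set of all reflections in $G(e,e,n+1)$. For $g\in G(e,e,n+1)$, $\mathrm{Red}_T(g)$ is the set of minimal length sequences $(t_1,\dots,t_k)$ of elements of $T$ with $g=t_1\cdots t_k$, and $l_T(g)$ is the length $k$ of such sequences. $g\preccurlyeq_T h$ means that there are $(t_1,\dots,t_k)\in\mathrm{Red}_T(h)$ and $l\leq k$ with $g=t_1\cdots t_l$. With coordinates $X_0,\dots,X_n$ on $\mathbb{C}^{n+1}$, $c\in G(e,e,n+1)$ is the element $c(X_0,X_1,\dots,X_n)=(\zeta_e^{-1}X_0,X_2,X_3,\dots,X_n,\zeta_eX_1)$, and $P_G:=\{g\in G(e,e,n+1)\mid g\preccurlyeq_T c\}$. If $l_T(g)=k$, then for $1\leq i\leq k-1$ set $$\sigma_i((t_1,\dots,t_k)):=(t_1,\dots,t_{i-1},t_it_{i+1}t_i^{-1},t_i,t_{i+2},\dots,t_k).$$ These are bijections of $\mathrm{Red}_T(g)$ satisfying the braid relations of the Artin group of type $A_{k-1}$ (the braid group on $k$ strings); the resulting action of this group on $\mathrm{Red}_T(g)$ is the Hurwitz action. *)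

theory Defs
  imports
    "HOL-Algebra.Group_Action"
    "HOL-Algebra.Generated_Groups"
    "HOL-Combinatorics.Permutations"
    "Jordan_Normal_Form.Determinant"
    "Jordan_Normal_Form.Matrix_Kernel"
begin

section \<open>The group $G(e,e,n+1)$ and its reflections\<close>

text \<open>Coordinates $X_0,\dots,X_n$ of $\mathbb{C}^{n+1}$ are the row and column indices
  \<open>0,\<dots>,n\<close> of square matrices of size \<open>Suc n\<close>; matrices act on column vectors.\<close>

definition GL :: "nat \<Rightarrow> complex mat monoid" where
  "GL m = units_of (ring_mat TYPE(complex) m ())"

definition perm_mats :: "nat \<Rightarrow> complex mat set" where
  "perm_mats m = {mat m m (\<lambda>(i, j). if i = p j then 1 else 0) | p. p permutes {..<m}}"

definition diag_mats :: "nat \<Rightarrow> nat \<Rightarrow> complex mat set" where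
  "diag_mats e m = {D \<in> carrier_mat m m.
     diagonal_mat D \<and> (\<forall>i<m. (D $$ (i, i)) ^ e = 1) \<and> det D = 1}"

definition Geen :: "nat \<Rightarrow> nat \<Rightarrow> complex mat set" where
  "Geen e n = generate (GL (Suc n)) (perm_mats (Suc n) \<union> diag_mats e (Suc n))"

text \<open>A reflection is an element whose fixed space is a hyperplane; finite order is
  automatic for elements of a finite group.\<close>

definition reflections :: "nat \<Rightarrow> nat \<Rightarrow> complex mat set" where
  "reflections e n = {t \<in> Geen e n. kernel_dim (t - 1\<^sub>m (Suc n)) = n}"

section \<open>Reduced decompositions\<close>

definition list_prod :: "nat \<Rightarrow> complex mat list \<Rightarrow> complex mat" where
  "list_prod n ts = foldr (\<otimes>\<^bsub>GL (Suc n)\<^esub>) ts \<one>\<^bsub>GL (Suc n)\<^esub>"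

definition decomps :: "nat \<Rightarrow> nat \<Rightarrow> complex mat \<Rightarrow> complex mat list set" where
  "decomps e n g = {ts. set ts \<subseteq> reflections e n \<and> list_prod n ts = g}"

definition Red_T :: "nat \<Rightarrow> nat \<Rightarrow> complex mat \<Rightarrow> complex mat list set" where
  "Red_T e n g = {ts \<in> decomps e n g. \<forall>us \<in> decomps e n g. length ts \<le> length us}"

definition l_T :: "nat \<Rightarrow> nat \<Rightarrow> complex mat \<Rightarrow> nat" where
  "l_T e n g = (THE k. \<exists>ts \<in> Red_T e n g. length ts = k)"

definition prefix_T :: "nat \<Rightarrow> nat \<Rightarrow> complex mat \<Rightarrow> complex mat \<Rightarrow> bool" where
  "prefix_T e n g h \<longleftrightarrow>
     (\<exists>ts \<in> Red_T e n h. \<exists>l \<le> length ts. g = list_prod n (take l ts))"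

definition zeta :: "nat \<Rightarrow> complex" where
  "zeta e = exp (2 * \<i> * of_real pi / of_nat e)"

definition cox :: "nat \<Rightarrow> nat \<Rightarrow> complex mat" where
  "cox e n = mat (Suc n) (Suc n) (\<lambda>(i, j).
     if i = 0 then (if j = 0 then inverse (zeta e) else 0)
     else if i < n then (if j = Suc i then 1 else 0)
     else (if j = 1 then zeta e else 0))"

lemma cox_mult_vec:
  assumes "n \<ge> 1"
  shows "cox e n *\<^sub>v vec (Suc n) X = vec (Suc n) (\<lambda>i.
    if i = 0 then inverse (zeta e) * X 0 else if i < n then X (Suc i) else zeta e * X 1)"
proof (rule eq_vecI)
  fix i
  assume "i < dim_vec (vec (Suc n) (\<lambda>i. if i = 0 then inverse (zeta e) * X 0
    else if i < n then X (Suc i) else zeta e * X 1))"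
  then have i: "i < Suc n" by simp
  have "(cox e n *\<^sub>v vec (Suc n) X) $ i = (\<Sum>j<Suc n. cox e n $$ (i, j) * X j)"
    using i by (simp add: cox_def scalar_prod_def atLeast0LessThan)
  also have "\<dots> = (\<Sum>j<Suc n. if j = (if i = 0 then 0 else if i < n then Suc i else 1)
      then (if i = 0 then inverse (zeta e) else if i < n then 1 else zeta e) * X j else 0)"
    using i by (intro sum.cong) (auto simp: cox_def)
  also have "\<dots> = (if i = 0 then inverse (zeta e) * X 0
      else if i < n then X (Suc i) else zeta e * X 1)"
    using assms i by (simp add: sum.delta)
  finally show "(cox e n *\<^sub>v vec (Suc n) X) $ i = vec (Suc n) (\<lambda>i.
      if i = 0 then inverse (zeta e) * X 0 else if i < n then X (Suc i) else zeta e * X 1) $ i"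
    using i by simp
qed (simp add: cox_def)

definition P_G :: "nat \<Rightarrow> nat \<Rightarrow> complex mat set" where
  "P_G e n = {g \<in> Geen e n. prefix_T e n g (cox e n)}"

section \<open>The braid group on \<open>k\<close> strings\<close>

text \<open>The Artin group of type $A_{k-1}$, by its presentation. The letters \<open>(True, i)\<close> and
  \<open>(False, i)\<close>, with \<open>1 \<le> i < k\<close>, stand for $\sigma_i$ and $\sigma_i^{-1}$.\<close>

definition braid_words :: "nat \<Rightarrow> (bool \<times> nat) list set" where
  "braid_words k = lists (UNIV \<times> {1..<k})"

inductive braid_eq :: "nat \<Rightarrow> (bool \<times> nat) list \<Rightarrow> (bool \<times> nat) list \<Rightarrow> bool" for k where
  refl: "w \<in> braid_words k \<Longrightarrow> braid_eq k w w"
| sym: "braid_eq k u v \<Longrightarrow> braid_eq k v u"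
| trans: "braid_eq k u v \<Longrightarrow> braid_eq k v w \<Longrightarrow> braid_eq k u w"
| append: "braid_eq k u u' \<Longrightarrow> braid_eq k v v' \<Longrightarrow> braid_eq k (u @ v) (u' @ v')"
| cancel: "1 \<le> i \<Longrightarrow> i < k \<Longrightarrow> braid_eq k [(b, i), (\<not> b, i)] []"
| commute: "1 \<le> i \<Longrightarrow> i + 2 \<le> j \<Longrightarrow> j < k \<Longrightarrow>
    braid_eq k [(True, i), (True, j)] [(True, j), (True, i)]"
| braid: "1 \<le> i \<Longrightarrow> i + 1 < k \<Longrightarrow>
    braid_eq k [(True, i), (True, i + 1), (True, i)] [(True, i + 1), (True, i), (True, i + 1)]"

definition braid_rel :: "nat \<Rightarrow> ((bool \<times> nat) list \<times> (bool \<times> nat) list) set" where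
  "braid_rel k = {(u, v). braid_eq k u v}"

definition braid_group :: "nat \<Rightarrow> (bool \<times> nat) list set monoid" where
  "braid_group k =
    \<lparr>carrier = braid_words k // braid_rel k,
     monoid.mult = (\<lambda>A B. braid_rel k `` {u @ v | u v. u \<in> A \<and> v \<in> B}),
     one = braid_rel k `` {[]}\<rparr>"

section \<open>The Hurwitz action\<close>

text \<open>With $t_1,\dots,t_k$ numbered from \<open>1\<close>, $t_i$ is \<open>ts ! (i - 1)\<close>.\<close>

definition hurwitz_sigma :: "nat \<Rightarrow> nat \<Rightarrow> complex mat list \<Rightarrow> complex mat list" where
  "hurwitz_sigma n i ts = ts
     [i - 1 := ts ! (i - 1) \<otimes>\<^bsub>GL (Suc n)\<^esub> ts ! i \<otimes>\<^bsub>GL (Suc n)\<^esub> inv\<^bsub>GL (Suc n)\<^esub> (ts ! (i - 1)),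
      i := ts ! (i - 1)]"

definition word_eval :: "('a, 'b) monoid_scheme \<Rightarrow> (nat \<Rightarrow> 'a) \<Rightarrow> (bool \<times> nat) list \<Rightarrow> 'a" where
  "word_eval H s w =
     foldr (\<lambda>(b, i) y. (if b then s i else inv\<^bsub>H\<^esub> (s i)) \<otimes>\<^bsub>H\<^esub> y) w \<one>\<^bsub>H\<^esub>"

text \<open>A braid, i.e. a class of words, acts as the common value of its words in the group of
  bijections of \<open>Red_T e n g\<close> (elements of \<open>BijGroup\<close> are extensional, hence the \<open>restrict\<close>).\<close>

definition hurwitz_action ::
    "nat \<Rightarrow> nat \<Rightarrow> complex mat \<Rightarrow> (bool \<times> nat) list set \<Rightarrow> complex mat list \<Rightarrow> complex mat list" where
  "hurwitz_action e n g \<beta> =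
     the_elem (word_eval (BijGroup (Red_T e n g)) (\<lambda>i. restrict (hurwitz_sigma n i) (Red_T e n g)) ` \<beta>)"

end

theory Submission
  imports Defs
begin

text \<open>A reflection of \<open>G(e,e,n+1)\<close> exchanges two coordinate lines, so a decomposition is a list of edges
  on the vertices \<open>0,\<dots>,n\<close>. If \<open>g\<close> moves the line of \<open>e\<^sub>k\<close>, there is a unique reflection \<open>s\<close> such that
  \<open>s g\<close> fixes \<open>e\<^sub>k\<close>, and Hurwitz moves bring every reduced decomposition of \<open>g\<close> into a form that starts
  with \<open>s\<close>. By induction on the length it remains to treat diagonal elements. There, every eigenvalue
  \<open>w \<noteq> 1\<close> produces a pair of reflections along the same edge. A reduced decomposition of \<open>c\<close> has at most
  \<open>n + 1\<close> edges, which form a connected graph because the only blocks of coordinates on which \<open>c\<close> has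
  weight one are trivial. Hence a diagonal factor of \<open>c\<close> consists of a single double edge, and comparing
  weights on the two sides of that edge gives \<open>w = \<zeta>\<^sub>e\<close> or its inverse. The decompositions of such an element
  are indexed by the \<open>e\<close>-th roots of unity, and a Hurwitz move multiplies the index by \<open>w\<close>.\<close>

section \<open>The braid group and its representations\<close>

lemma braid_words_append [simp]:
  "u @ v \<in> braid_words k \<longleftrightarrow> u \<in> braid_words k \<and> v \<in> braid_words k"
  by (auto simp: braid_words_def)

lemma braid_words_Nil [simp]: "[] \<in> braid_words k"
  by (simp add: braid_words_def)

lemma braid_words_Cons [simp]:
  "(b, i) # w \<in> braid_words k \<longleftrightarrow> 1 \<le> i \<and> i < k \<and> w \<in> braid_words k"
  by (auto simp: braid_words_def)

lemma braid_eq_braid_words: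
  "braid_eq k u v \<Longrightarrow> u \<in> braid_words k \<and> v \<in> braid_words k"
  by (induction rule: braid_eq.induct) auto

lemma equiv_braid_rel: "equiv (braid_words k) (braid_rel k)"
  unfolding equiv_def refl_on_def sym_def trans_def braid_rel_def
  using braid_eq_braid_words by (auto intro: braid_eq.refl braid_eq.sym braid_eq.trans)

abbreviation braid_class :: "nat \<Rightarrow> (bool \<times> nat) list \<Rightarrow> (bool \<times> nat) list set" where
  "braid_class k w \<equiv> braid_rel k `` {w}"

lemma braid_class_eqI: "braid_eq k u v \<Longrightarrow> braid_class k u = braid_class k v"
  by (rule equiv_class_eq[OF equiv_braid_rel]) (simp add: braid_rel_def)

lemma braid_class_self: "w \<in> braid_words k \<Longrightarrow> w \<in> braid_class k w"
  by (simp add: braid_rel_def braid_eq.refl)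

lemma carrier_braid_group_iff:
  "A \<in> carrier (braid_group k) \<longleftrightarrow> (\<exists>w\<in>braid_words k. A = braid_class k w)"
  by (auto simp: braid_group_def quotient_def)

text \<open>\<open>braid_group\<close> multiplies classes by saturating the set of all
  concatenations, so no representatives are chosen. Since \<open>braid_eq\<close> is a congruence,
  these concatenations lie in one class.\<close>

lemma braid_class_mult:
  assumes "u \<in> braid_words k" "v \<in> braid_words k"
  shows "braid_class k u \<otimes>\<^bsub>braid_group k\<^esub> braid_class k v = braid_class k (u @ v)"
proof -
  let ?S = "{x @ y | x y. x \<in> braid_class k u \<and> y \<in> braid_class k v}"
  have "braid_rel k `` ?S = braid_class k (u @ v)"
  proof
    show "braid_rel k `` ?S \<subseteq> braid_class k (u @ v)"
    proof
      fix z assume "z \<in> braid_rel k `` ?S"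
      then obtain x y where "braid_eq k u x" "braid_eq k v y" "braid_eq k (x @ y) z"
        by (auto simp: braid_rel_def)
      then show "z \<in> braid_class k (u @ v)"
        by (auto simp: braid_rel_def intro: braid_eq.trans[OF braid_eq.append])
    qed
    have "u @ v \<in> ?S" using assms braid_class_self by blast
    then show "braid_class k (u @ v) \<subseteq> braid_rel k `` ?S" by blast
  qed
  then show ?thesis by (simp add: braid_group_def)
qed

section \<open>Inverse braids and the group axioms\<close>

definition inverse_word :: "(bool \<times> nat) list \<Rightarrow> (bool \<times> nat) list" where
  "inverse_word w = map (\<lambda>(b, i). (\<not> b, i)) (rev w)"

lemma inverse_word_braid_words: "w \<in> braid_words k \<Longrightarrow> inverse_word w \<in> braid_words k"
  by (fastforce simp: inverse_word_def braid_words_def)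

lemma inverse_word_braid_eq:
  "w \<in> braid_words k \<Longrightarrow> braid_eq k (inverse_word w @ w) []"
proof (induction w)
  case Nil
  then show ?case by (simp add: inverse_word_def braid_eq.refl)
next
  case (Cons a w)
  obtain b i where a: "a = (b, i)" by (cases a)
  have i: "1 \<le> i" "i < k" and w: "w \<in> braid_words k" using Cons.prems a by auto
  \<comment> \<open>The two letters that meet in the middle cancel. The doubled negation gives the
    pair the shape of the rule \<open>cancel\<close>.\<close>
  have "braid_eq k (inverse_word w @ ([(\<not> b, i), (\<not> \<not> b, i)] @ w)) (inverse_word w @ ([] @ w))"
    using w inverse_word_braid_words[OF w] i
    by (intro braid_eq.append braid_eq.refl braid_eq.cancel)
  then show ?case
    using braid_eq.trans[OF _ Cons.IH[OF w]] by (simp add: inverse_word_def a)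
qed

lemma group_braid_group: "group (braid_group k)"
proof (rule groupI)
  have one: "\<one>\<^bsub>braid_group k\<^esub> = braid_class k []" by (simp add: braid_group_def)
  fix x y assume "x \<in> carrier (braid_group k)" "y \<in> carrier (braid_group k)"
  then obtain u v where uv: "u \<in> braid_words k" "v \<in> braid_words k"
    "x = braid_class k u" "y = braid_class k v"
    by (auto simp: carrier_braid_group_iff)
  then show "x \<otimes>\<^bsub>braid_group k\<^esub> y \<in> carrier (braid_group k)"
    by (auto simp: braid_class_mult carrier_braid_group_iff)
  show "\<one>\<^bsub>braid_group k\<^esub> \<otimes>\<^bsub>braid_group k\<^esub> x = x"
    using uv by (simp add: one braid_class_mult)
  show "\<exists>y\<in>carrier (braid_group k). y \<otimes>\<^bsub>braid_group k\<^esub> x = \<one>\<^bsub>braid_group k\<^esub>"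
    using uv inverse_word_braid_words[of u k] braid_class_eqI[OF inverse_word_braid_eq[of u k]]
    by (intro bexI[of _ "braid_class k (inverse_word u)"])
      (auto simp: one braid_class_mult carrier_braid_group_iff)
  fix z assume "z \<in> carrier (braid_group k)"
  then obtain w where "w \<in> braid_words k" "z = braid_class k w"
    by (auto simp: carrier_braid_group_iff)
  then show "x \<otimes>\<^bsub>braid_group k\<^esub> y \<otimes>\<^bsub>braid_group k\<^esub> z = x \<otimes>\<^bsub>braid_group k\<^esub> (y \<otimes>\<^bsub>braid_group k\<^esub> z)"
    using uv by (simp add: braid_class_mult)
next
  show "\<one>\<^bsub>braid_group k\<^esub> \<in> carrier (braid_group k)"
    by (auto simp: carrier_braid_group_iff) (auto simp: braid_group_def intro!: bexI[of _ "[]"])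
qed

section \<open>Representations given by generators satisfying the braid relations\<close>

locale braid_rep = group H for H (structure) +
  fixes k :: nat and s :: "nat \<Rightarrow> 'a"
  assumes s_closed: "1 \<le> i \<Longrightarrow> i < k \<Longrightarrow> s i \<in> carrier H"
    and s_commute: "1 \<le> i \<Longrightarrow> i + 2 \<le> j \<Longrightarrow> j < k \<Longrightarrow> s i \<otimes> s j = s j \<otimes> s i"
    and s_braid: "1 \<le> i \<Longrightarrow> i + 1 < k \<Longrightarrow>
      s i \<otimes> (s (i + 1) \<otimes> s i) = s (i + 1) \<otimes> (s i \<otimes> s (i + 1))"
begin

lemma word_eval_Nil [simp]: "word_eval H s [] = \<one>"
  by (simp add: word_eval_def)

lemma word_eval_Cons [simp]:
  "word_eval H s ((b, i) # w) = (if b then s i else inv (s i)) \<otimes> word_eval H s w"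
  by (simp add: word_eval_def)

lemma word_eval_closed: "w \<in> braid_words k \<Longrightarrow> word_eval H s w \<in> carrier H"
proof (induction w)
  case (Cons a w)
  then show ?case using s_closed by (cases a) simp
qed simp

lemma word_eval_append:
  assumes "v \<in> braid_words k"
  shows "u \<in> braid_words k \<Longrightarrow> word_eval H s (u @ v) = word_eval H s u \<otimes> word_eval H s v"
proof (induction u)
  case (Cons a u)
  then show ?case
    using s_closed word_eval_closed assms by (cases a) (auto simp: m_assoc)
qed (use word_eval_closed assms in simp)

lemma word_eval_braid_eq: "braid_eq k u v \<Longrightarrow> word_eval H s u = word_eval H s v"
proof (induction rule: braid_eq.induct)
  case (append u u' v v')
  then show ?case using braid_eq_braid_words by (metis word_eval_append)
next
  case (cancel i b)
  then show ?case using s_closed by simp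
next
  case (commute i j)
  then show ?case using s_closed s_commute[of i j] by simp
next
  case (braid i)
  then show ?case using s_closed[of i] s_closed[of "i + 1"] s_braid[of i] by simp
qed auto

text \<open>Words of one class have one value, so the image of the class is a singleton and
  \<open>the_elem\<close> is meaningful on it.\<close>

lemma the_elem_word_eval:
  assumes "w \<in> braid_words k"
  shows "the_elem (word_eval H s ` braid_class k w) = word_eval H s w"
proof -
  have "word_eval H s v = word_eval H s w" if "v \<in> braid_class k w" for v
    using that word_eval_braid_eq[of w v] by (simp add: braid_rel_def)
  then have "word_eval H s ` braid_class k w = {word_eval H s w}"
    using braid_class_self[OF assms] by blast
  then show ?thesis by simp
qed

lemma hom_braid_group:
  "(\<lambda>\<beta>. the_elem (word_eval H s ` \<beta>)) \<in> hom (braid_group k) H"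
  by (rule homI)
    (auto simp: carrier_braid_group_iff braid_class_mult the_elem_word_eval word_eval_closed
      word_eval_append)

end

section \<open>Hurwitz moves\<close>

text \<open>The orbit relation generated by single moves, free of positions and braid words, so that
  moves can be made inside any longer list. Rule \<open>sym\<close> supplies the inverse
  moves.\<close>

inductive hurwitz_equiv :: "('a, 'b) monoid_scheme \<Rightarrow> 'a list \<Rightarrow> 'a list \<Rightarrow> bool" for G where
  refl: "hurwitz_equiv G us us"
| move: "a \<in> carrier G \<Longrightarrow> b \<in> carrier G \<Longrightarrow>
    hurwitz_equiv G (us @ a # b # vs) (us @ (a \<otimes>\<^bsub>G\<^esub> b \<otimes>\<^bsub>G\<^esub> inv\<^bsub>G\<^esub> a) # a # vs)"
| sym: "hurwitz_equiv G us vs \<Longrightarrow> hurwitz_equiv G vs us"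
| trans: "hurwitz_equiv G us vs \<Longrightarrow> hurwitz_equiv G vs ws \<Longrightarrow> hurwitz_equiv G us ws"

lemma hurwitz_equiv_append:
  "hurwitz_equiv G us vs \<Longrightarrow> hurwitz_equiv G (xs @ us @ ys) (xs @ vs @ ys)"
proof (induction rule: hurwitz_equiv.induct)
  case (move a b us vs)
  then show ?case using hurwitz_equiv.move[of a G b "xs @ us" "vs @ ys"] by simp
qed (auto intro: hurwitz_equiv.intros)

lemma hurwitz_equiv_Cons: "hurwitz_equiv G us vs \<Longrightarrow> hurwitz_equiv G (x # us) (x # vs)"
  using hurwitz_equiv_append[of G us vs "[x]" "[]"] by simp

lemma hurwitz_equiv_length: "hurwitz_equiv G us vs \<Longrightarrow> length us = length vs"
  by (induction rule: hurwitz_equiv.induct) auto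

section \<open>Invariants of Hurwitz moves\<close>

definition prod_list_in :: "('a, 'b) monoid_scheme \<Rightarrow> 'a list \<Rightarrow> 'a" where
  "prod_list_in G ts = foldr (\<otimes>\<^bsub>G\<^esub>) ts \<one>\<^bsub>G\<^esub>"

context group
begin

lemma prod_list_in_closed: "set ts \<subseteq> carrier G \<Longrightarrow> prod_list_in G ts \<in> carrier G"
  by (induction ts) (auto simp: prod_list_in_def)

lemma prod_list_in_Nil [simp]: "prod_list_in G [] = \<one>"
  by (simp add: prod_list_in_def)

lemma prod_list_in_Cons [simp]: "prod_list_in G (t # ts) = t \<otimes> prod_list_in G ts"
  by (simp add: prod_list_in_def)

lemma prod_list_in_append:
  "set us \<subseteq> carrier G \<Longrightarrow> set vs \<subseteq> carrier G \<Longrightarrow>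
   prod_list_in G (us @ vs) = prod_list_in G us \<otimes> prod_list_in G vs"
  by (induction us) (auto simp: m_assoc prod_list_in_closed)

lemma conj_mult_cancel:
  assumes "a \<in> carrier G" "b \<in> carrier G"
  shows "a \<otimes> b \<otimes> inv a \<otimes> a = a \<otimes> b"
  using assms by (simp add: m_assoc)

lemma hurwitz_equiv_set_carrier:
  "hurwitz_equiv G us vs \<Longrightarrow> set us \<subseteq> carrier G \<longleftrightarrow> set vs \<subseteq> carrier G"
  by (induction rule: hurwitz_equiv.induct) auto

lemma hurwitz_equiv_prod:
  "hurwitz_equiv G us vs \<Longrightarrow> set us \<subseteq> carrier G \<Longrightarrow> prod_list_in G us = prod_list_in G vs"
proof (induction rule: hurwitz_equiv.induct)
  case (move a b us vs)
  let ?p = "prod_list_in G vs"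
  have p: "?p \<in> carrier G" using move by (intro prod_list_in_closed) auto
  have "a \<otimes> (b \<otimes> ?p) = (a \<otimes> b \<otimes> inv a) \<otimes> (a \<otimes> ?p)"
    using move p conj_mult_cancel[of a b] by (metis inv_closed m_assoc m_closed)
  then show ?case using move by (simp add: prod_list_in_append)
next
  case (sym us vs)
  then show ?case using hurwitz_equiv_set_carrier by metis
next
  case (trans us vs ws)
  then show ?case using hurwitz_equiv_set_carrier by metis
qed simp

text \<open>A derivation may also run a move backwards, hence the closure under conjugation by
  inverses.\<close>

lemma hurwitz_equiv_set:
  assumes T: "T \<subseteq> carrier G" "\<And>a b. a \<in> T \<Longrightarrow> b \<in> T \<Longrightarrow> a \<otimes> b \<otimes> inv a \<in> T"
    "\<And>a b. a \<in> T \<Longrightarrow> b \<in> T \<Longrightarrow> inv a \<otimes> b \<otimes> a \<in> T"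
  shows "hurwitz_equiv G us vs \<Longrightarrow> set us \<subseteq> T \<longleftrightarrow> set vs \<subseteq> T"
proof (induction rule: hurwitz_equiv.induct)
  case (move a b us vs)
  have "inv a \<otimes> (a \<otimes> b \<otimes> inv a) \<otimes> a = b"
    using move by (metis conj_mult_cancel inv_closed inv_solve_left' l_inv m_assoc m_closed r_one r_inv)
  then have "a \<otimes> b \<otimes> inv a \<in> T \<longleftrightarrow> b \<in> T" if "a \<in> T"
    using T that move by metis
  then show ?case by auto
qed auto

text \<open>This is an inverse braid generator: the right entry passes to the left unchanged. In
  this way a chosen reflection can be brought to the front.\<close>

lemma hurwitz_equiv_back:
  assumes "a \<in> carrier G" "b \<in> carrier G"
  shows "hurwitz_equiv G (us @ a # b # vs) (us @ b # (inv b \<otimes> a \<otimes> b) # vs)"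
proof -
  have "b \<otimes> (inv b \<otimes> a \<otimes> b) \<otimes> inv b = a"
    using assms by (metis inv_closed inv_inv inv_solve_left' m_assoc m_closed r_inv r_one)
  then show ?thesis
    using hurwitz_equiv.move[of b G "inv b \<otimes> a \<otimes> b" us vs] assms
    by (auto intro: hurwitz_equiv.sym)
qed

end

section \<open>The Hurwitz action\<close>

definition hurwitz_move :: "('a, 'b) monoid_scheme \<Rightarrow> nat \<Rightarrow> 'a list \<Rightarrow> 'a list" where
  "hurwitz_move G i ts = ts
     [i - 1 := ts ! (i - 1) \<otimes>\<^bsub>G\<^esub> ts ! i \<otimes>\<^bsub>G\<^esub> inv\<^bsub>G\<^esub> (ts ! (i - 1)), i := ts ! (i - 1)]"

lemma hurwitz_move_append:
  "i = Suc (length us) \<Longrightarrow> hurwitz_move G i (us @ a # b # vs) =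
     us @ (a \<otimes>\<^bsub>G\<^esub> b \<otimes>\<^bsub>G\<^esub> inv\<^bsub>G\<^esub> a) # a # vs"
  by (simp add: hurwitz_move_def nth_append list_update_append)

lemma split_at_pair:
  assumes "1 \<le> i" "i < length ts"
  shows "\<exists>us a b vs. ts = us @ a # b # vs \<and> i = Suc (length us)"
proof -
  have "ts = take (i - 1) ts @ ts ! (i - 1) # drop i ts"
    using id_take_nth_drop[of "i - 1" ts] assms by simp
  moreover have "drop i ts = ts ! i # drop (Suc i) ts"
    using assms by (simp add: Cons_nth_drop_Suc)
  ultimately have "ts = take (i - 1) ts @ ts ! (i - 1) # ts ! i # drop (Suc i) ts" by simp
  moreover have "i = Suc (length (take (i - 1) ts))" using assms by simp
  ultimately show ?thesis by blast
qed

lemma hurwitz_move_commute: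
  assumes "1 \<le> i" "i + 2 \<le> j" "j < length ts"
  shows "hurwitz_move G i (hurwitz_move G j ts) = hurwitz_move G j (hurwitz_move G i ts)"
  using assms by (intro nth_equalityI) (auto simp: hurwitz_move_def nth_list_update)

text \<open>Both sides send three neighbours \<open>a, b, c\<close> to
  \<open>a b c (a b)^-1, a b a^-1, a\<close>.\<close>

lemma (in group) hurwitz_move_braid:
  assumes i: "1 \<le> i" "i + 1 < length ts" and ts: "set ts \<subseteq> carrier G"
  shows "hurwitz_move G i (hurwitz_move G (i + 1) (hurwitz_move G i ts)) =
    hurwitz_move G (i + 1) (hurwitz_move G i (hurwitz_move G (i + 1) ts))"
proof -
  obtain us a b vs where 1: "ts = us @ a # b # vs" "i = Suc (length us)"
    using split_at_pair[of i ts] i by auto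
  then obtain c ws where ts': "ts = us @ a # b # c # ws"
    using i by (cases vs) auto
  have abc: "a \<in> carrier G" "b \<in> carrier G" "c \<in> carrier G" using ts ts' by auto
  have move1: "hurwitz_move G (Suc (length us)) (us @ x # y # zs) = us @ (x \<otimes> y \<otimes> inv x) # x # zs"
    for x y zs by (rule hurwitz_move_append) simp
  have move2: "hurwitz_move G (Suc (Suc (length us))) (us @ x # y # z # zs) =
      us @ x # (y \<otimes> z \<otimes> inv y) # y # zs" for x y z zs
    using hurwitz_move_append[of _ "us @ [x]" G y z zs] by simp
  have cancel: "inv a \<otimes> (a \<otimes> x) = x" if "x \<in> carrier G" for x
    using abc that by (simp add: m_assoc[symmetric])
  have "a \<otimes> b \<otimes> inv a \<otimes> (a \<otimes> c \<otimes> inv a) \<otimes> inv (a \<otimes> b \<otimes> inv a) =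
      a \<otimes> (b \<otimes> c \<otimes> inv b) \<otimes> inv a"
    using abc by (simp add: m_assoc inv_mult_group cancel)
  then show ?thesis by (simp add: ts' 1 move1 move2)
qed

text \<open>This isolates what makes the generators act on \<open>Red_T e n g\<close> by bijections:
  a common length, entries in the group, and stability under Hurwitz moves.\<close>

locale hurwitz_closed = group +
  fixes E :: "'a list set" and k :: nat
  assumes length_E: "ts \<in> E \<Longrightarrow> length ts = k"
    and carrier_E: "ts \<in> E \<Longrightarrow> set ts \<subseteq> carrier G"
    and hurwitz_equiv_E: "ts \<in> E \<Longrightarrow> hurwitz_equiv G ts us \<Longrightarrow> us \<in> E"
begin

lemma hurwitz_equiv_hurwitz_move:
  assumes "1 \<le> i" "i < k" "ts \<in> E"
  shows "hurwitz_equiv G ts (hurwitz_move G i ts)"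
proof -
  obtain us a b vs where "ts = us @ a # b # vs" "i = Suc (length us)"
    using assms length_E split_at_pair[of i ts] by auto
  then show ?thesis
    using carrier_E[OF assms(3)] by (auto simp: hurwitz_move_append intro: hurwitz_equiv.move)
qed

lemma hurwitz_move_E: "1 \<le> i \<Longrightarrow> i < k \<Longrightarrow> ts \<in> E \<Longrightarrow> hurwitz_move G i ts \<in> E"
  using hurwitz_equiv_hurwitz_move hurwitz_equiv_E by blast

lemma hurwitz_move_inj:
  assumes "1 \<le> i" "i < k" "ts \<in> E" "ts' \<in> E" "hurwitz_move G i ts = hurwitz_move G i ts'"
  shows "ts = ts'"
proof -
  obtain us a b vs where ts: "ts = us @ a # b # vs" "i = Suc (length us)"
    using assms length_E split_at_pair[of i ts] by auto
  obtain us' a' b' vs' where ts': "ts' = us' @ a' # b' # vs'" "i = Suc (length us')"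
    using assms length_E split_at_pair[of i ts'] by auto
  have c: "a \<in> carrier G" "b \<in> carrier G" "b' \<in> carrier G"
    using carrier_E[OF assms(3)] carrier_E[OF assms(4)] ts ts' by auto
  have e: "us = us'" "vs = vs'" "a = a'" and conj: "a \<otimes> b \<otimes> inv a = a \<otimes> b' \<otimes> inv a"
    using assms(5) ts ts' by (auto simp: hurwitz_move_append)
  have "a \<otimes> b = a \<otimes> b'"
    using conj_mult_cancel[of a b] conj_mult_cancel[of a b'] c conj by metis
  then have "b = b'" using c by simp
  then show ?thesis using e ts ts' by simp
qed

lemma hurwitz_move_Bij:
  assumes i: "1 \<le> i" "i < k"
  shows "restrict (hurwitz_move G i) E \<in> Bij E"
proof -
  have "ts \<in> hurwitz_move G i ` E" if m: "ts \<in> E" for ts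
  proof -
    obtain us c d vs where ts: "ts = us @ c # d # vs" "i = Suc (length us)"
      using i m length_E split_at_pair[of i ts] by auto
    have cd: "c \<in> carrier G" "d \<in> carrier G" using carrier_E[OF m] ts by auto
    \<comment> \<open>The inverse move provides the preimage.\<close>
    let ?ts = "us @ d # (inv d \<otimes> c \<otimes> d) # vs"
    have "d \<otimes> (inv d \<otimes> c \<otimes> d) \<otimes> inv d = c"
      using cd by (metis inv_closed inv_solve_left' m_assoc m_closed r_inv r_one)
    then have "hurwitz_move G i ?ts = ts" by (simp add: ts hurwitz_move_append)
    moreover have "?ts \<in> E"
      using hurwitz_equiv_E[OF m] hurwitz_equiv_back[OF cd] ts by auto
    ultimately show ?thesis by (metis imageI)
  qed
  then have "bij_betw (hurwitz_move G i) E E"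
    unfolding bij_betw_def inj_on_def
    using hurwitz_move_inj[OF i] hurwitz_move_E[OF i] by (auto simp del: One_nat_def)
  then have "bij_betw (restrict (hurwitz_move G i) E) E E"
    by (rule bij_betw_cong[THEN iffD1, rotated]) simp
  then show ?thesis by (simp add: Bij_def)
qed

lemma braid_rep_hurwitz_move:
  "braid_rep (BijGroup E) k (\<lambda>i. restrict (hurwitz_move G i) E)"
proof (rule braid_rep.intro[OF group_BijGroup], unfold_locales)
  let ?s = "\<lambda>i. restrict (hurwitz_move G i) E"
  have closed: "?s i \<in> carrier (BijGroup E)" if "1 \<le> i" "i < k" for i
    using that hurwitz_move_Bij by (simp add: BijGroup_def)
  have mult: "f \<otimes>\<^bsub>BijGroup E\<^esub> g = compose E f g"
    if "f \<in> carrier (BijGroup E)" "g \<in> carrier (BijGroup E)" for f g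
    using that by (simp add: BijGroup_def)
  have mult_closed: "f \<otimes>\<^bsub>BijGroup E\<^esub> g \<in> carrier (BijGroup E)"
    if "f \<in> carrier (BijGroup E)" "g \<in> carrier (BijGroup E)" for f g
    using that monoid.m_closed[OF group.is_monoid[OF group_BijGroup]] by blast
  show "1 \<le> i \<Longrightarrow> i < k \<Longrightarrow> ?s i \<in> carrier (BijGroup E)" for i by (rule closed)
  show "?s i \<otimes>\<^bsub>BijGroup E\<^esub> ?s j = ?s j \<otimes>\<^bsub>BijGroup E\<^esub> ?s i"
    if ij: "1 \<le> i" "i + 2 \<le> j" "j < k" for i j
  proof -
    have "compose E (?s i) (?s j) = compose E (?s j) (?s i)"
      unfolding compose_def
      using ij hurwitz_move_E length_E
      by (intro restrict_ext) (auto intro!: hurwitz_move_commute)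
    then show ?thesis using ij by (simp add: mult closed)
  qed
  show "?s i \<otimes>\<^bsub>BijGroup E\<^esub> (?s (i + 1) \<otimes>\<^bsub>BijGroup E\<^esub> ?s i) =
      ?s (i + 1) \<otimes>\<^bsub>BijGroup E\<^esub> (?s i \<otimes>\<^bsub>BijGroup E\<^esub> ?s (i + 1))"
    if i: "1 \<le> i" "i + 1 < k" for i
  proof -
    have "compose E (?s i) (compose E (?s (i + 1)) (?s i)) =
        compose E (?s (i + 1)) (compose E (?s i) (?s (i + 1)))"
      unfolding compose_def
      using i hurwitz_move_E length_E carrier_E hurwitz_move_braid[of i]
      by (intro restrict_ext) simp
    then show ?thesis
      using i closed[of i] closed[of "i + 1"] mult_closed[of "?s i" "?s (i + 1)"]
        mult_closed[of "?s (i + 1)" "?s i"]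
      by (simp add: mult)
  qed
qed

text \<open>A derivation of a Hurwitz equivalence is read as a braid: \<open>refl\<close> gives the
  identity, \<open>move\<close> a generator, \<open>sym\<close> an inverse and \<open>trans\<close>
  a product.\<close>

lemma transitive_action_hurwitz:
  assumes trans: "\<And>us vs. us \<in> E \<Longrightarrow> vs \<in> E \<Longrightarrow> hurwitz_equiv G us vs"
  shows "transitive_action (braid_group k) E
    (\<lambda>\<beta>. the_elem (word_eval (BijGroup E) (\<lambda>i. restrict (hurwitz_move G i) E) ` \<beta>))"
    (is "transitive_action _ _ ?\<phi>")
proof -
  interpret R: braid_rep "BijGroup E" k "\<lambda>i. restrict (hurwitz_move G i) E"
    by (rule braid_rep_hurwitz_move)
  have act: "group_action (braid_group k) E ?\<phi>"
    unfolding group_action_def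
    by (intro group_hom.intro group_hom_axioms.intro group_braid_group group_BijGroup
        R.hom_braid_group)
  then interpret A: group_action "braid_group k" E ?\<phi> .
  \<comment> \<open>Membership is carried along in both directions because \<open>sym\<close>
    exchanges the two lists.\<close>
  have orbit: "(us \<in> E \<longleftrightarrow> vs \<in> E) \<and> (us \<in> E \<longrightarrow> (\<exists>\<beta>\<in>carrier (braid_group k). ?\<phi> \<beta> us = vs))"
    if "hurwitz_equiv G us vs" for us vs
    using that
  proof (induction rule: hurwitz_equiv.induct)
    case (refl us)
    have "?\<phi> \<one>\<^bsub>braid_group k\<^esub> us = us" if "us \<in> E"
      using fun_cong[OF A.id_eq_one, of us] that by simp
    then show ?case using monoid.one_closed[OF group.is_monoid[OF group_braid_group]] by blast
  next
    case (move a b us vs)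
    let ?us = "us @ a # b # vs" and ?vs = "us @ (a \<otimes> b \<otimes> inv a) # a # vs"
    have eq: "hurwitz_equiv G ?us ?vs" using move by (rule hurwitz_equiv.move)
    then have iff: "?us \<in> E \<longleftrightarrow> ?vs \<in> E"
      using hurwitz_equiv_E hurwitz_equiv.sym by metis
    have "\<exists>\<beta>\<in>carrier (braid_group k). ?\<phi> \<beta> ?us = ?vs" if "?us \<in> E"
    proof
      let ?i = "Suc (length us)" and ?\<beta> = "braid_class k [(True, Suc (length us))]"
      have i: "1 \<le> ?i" "?i < k" using length_E[OF that] by auto
      then have w: "[(True, ?i)] \<in> braid_words k" by simp
      show "?\<beta> \<in> carrier (braid_group k)" using w by (auto simp: carrier_braid_group_iff)
      have "?\<phi> ?\<beta> = restrict (hurwitz_move G ?i) E"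
        using R.the_elem_word_eval[OF w] R.s_closed[OF i] by simp
      then show "?\<phi> ?\<beta> ?us = ?vs" using that by (simp add: hurwitz_move_append)
    qed
    then show ?case using iff by blast
  next
    case (sym us vs)
    have "?\<phi> (inv\<^bsub>braid_group k\<^esub> \<beta>) vs = us"
      if "\<beta> \<in> carrier (braid_group k)" "us \<in> E" "?\<phi> \<beta> us = vs" for \<beta>
      using that by (rule A.orbit_sym_aux)
    then show ?case using sym.IH group.inv_closed[OF group_braid_group] by blast
  next
    case (trans us vs ws)
    have "?\<phi> (\<gamma> \<otimes>\<^bsub>braid_group k\<^esub> \<beta>) us = ?\<phi> \<gamma> (?\<phi> \<beta> us)"
      if "us \<in> E" "\<gamma> \<in> carrier (braid_group k)" "\<beta> \<in> carrier (braid_group k)" for \<beta> \<gamma>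
      using that by (rule A.composition_rule)
    then show ?case
      using trans.IH monoid.m_closed[OF group.is_monoid[OF group_braid_group]] by metis
  qed
  show ?thesis
    using trans orbit by (intro transitive_action.intro[OF act] transitive_action_axioms.intro) blast
qed

end

lemma hurwitz_sigma_eq_hurwitz_move: "hurwitz_sigma n i = hurwitz_move (GL (Suc n)) i"
  by (simp add: fun_eq_iff hurwitz_sigma_def hurwitz_move_def)

section \<open>Monomial matrices\<close>

lemma GL_simps [simp]:
  "x \<otimes>\<^bsub>GL m\<^esub> y = x * y"
  "\<one>\<^bsub>GL m\<^esub> = 1\<^sub>m m"
  by (simp_all add: GL_def units_of_def ring_mat_simps)

lemma group_GL: "group (GL m)"
  unfolding GL_def
  by (rule monoid.units_group[OF ring.is_monoid[OF ring_mat]])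

lemma GL_carrierI:
  assumes "x \<in> carrier_mat m m" "y \<in> carrier_mat m m" "x * y = 1\<^sub>m m" "y * x = 1\<^sub>m m"
  shows "x \<in> carrier (GL m)"
  using assms by (auto simp: GL_def units_of_def Units_def ring_mat_simps)

lemma GL_carrier_mat: "x \<in> carrier (GL m) \<Longrightarrow> x \<in> carrier_mat m m"
  by (auto simp: GL_def units_of_def Units_def ring_mat_simps)

text \<open>The matrix \<open>mon m p a\<close> sends the basis vector \<open>e\<^sub>j\<close> to \<open>a j\<close> times \<open>e\<^bsub>p j\<^esub>\<close>.\<close>

definition mon :: "nat \<Rightarrow> (nat \<Rightarrow> nat) \<Rightarrow> (nat \<Rightarrow> complex) \<Rightarrow> complex mat" where
  "mon m p a = mat m m (\<lambda>(i, j). if i = p j then a j else 0)"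

lemma mon_carrier_mat [simp]: "mon m p a \<in> carrier_mat m m"
  by (simp add: mon_def)

lemma mon_cong: "(\<And>j. j < m \<Longrightarrow> p j = q j) \<Longrightarrow> (\<And>j. j < m \<Longrightarrow> a j = b j) \<Longrightarrow> mon m p a = mon m q b"
  by (rule eq_matI) (auto simp: mon_def)

lemma mon_id: "mon m id (\<lambda>_. 1) = 1\<^sub>m m"
  by (rule eq_matI) (auto simp: mon_def)

lemma mon_mult:
  assumes q: "q permutes {..<m}"
  shows "mon m p a * mon m q b = mon m (p \<circ> q) (\<lambda>j. a (q j) * b j)"
proof (rule eq_matI)
  fix i j assume "i < dim_row (mon m (p \<circ> q) (\<lambda>j. a (q j) * b j))"
    "j < dim_col (mon m (p \<circ> q) (\<lambda>j. a (q j) * b j))"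
  then have ij: "i < m" "j < m" by (auto simp: mon_def)
  have qj: "q j < m" using permutes_in_image[OF q] ij by auto
  have "(mon m p a * mon m q b) $$ (i, j) =
      (\<Sum>l<m. (if i = p l then a l else 0) * (if l = q j then b j else 0))"
    using ij by (simp add: mon_def scalar_prod_def atLeast0LessThan)
  also have "\<dots> = (\<Sum>l<m. if l = q j then (if i = p l then a l else 0) * b j else 0)"
    by (intro sum.cong) auto
  also have "\<dots> = (if i = p (q j) then a (q j) else 0) * b j"
    using qj by (simp add: sum.delta)
  finally show "(mon m p a * mon m q b) $$ (i, j) = mon m (p \<circ> q) (\<lambda>j. a (q j) * b j) $$ (i, j)"
    using ij by (simp add: mon_def)
qed (auto simp: mon_def)

text \<open>A nonzero coefficient marks the only nonzero entry of its column, which determines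
  \<open>p\<close> and \<open>a\<close> below \<open>m\<close>. From \<open>m\<close> on both
  permutations are the identity.\<close>

lemma mon_inject:
  assumes eq: "mon m p a = mon m q b"
    and p: "p permutes {..<m}" and q: "q permutes {..<m}"
    and a: "\<And>j. j < m \<Longrightarrow> a j \<noteq> 0"
  shows "p = q" "\<And>j. j < m \<Longrightarrow> a j = b j"
proof -
  have *: "p j = q j \<and> a j = b j" if j: "j < m" for j
  proof -
    have "p j < m" using permutes_in_image[OF p] j by auto
    then have "mon m p a $$ (p j, j) = a j"
      "mon m q b $$ (p j, j) = (if p j = q j then b j else 0)"
      using j by (auto simp: mon_def)
    then show ?thesis using eq a[OF j] by (auto split: if_splits)
  qed
  then show "\<And>j. j < m \<Longrightarrow> a j = b j" by blast
  show "p = q"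
  proof
    fix j show "p j = q j"
      using * p q by (cases "j < m") (auto simp: permutes_def)
  qed
qed

text \<open>The explicit form of the group, see \<open>Geen_eq_monomials\<close>. The condition is
  on the product of the coefficients because the determinant also contains the sign of
  \<open>p\<close>.\<close>

definition monomials :: "nat \<Rightarrow> nat \<Rightarrow> complex mat set" where
  "monomials e m = {mon m p a | p a. p permutes {..<m} \<and> (\<forall>i<m. a i ^ e = 1) \<and> (\<Prod>i<m. a i) = 1}"

lemma monomialsE:
  assumes "g \<in> monomials e m"
  obtains p a where "g = mon m p a" "p permutes {..<m}" "\<And>i. i < m \<Longrightarrow> a i ^ e = 1"
    "(\<Prod>i<m. a i) = 1"
  using assms unfolding monomials_def by blast

lemma monomialsI:
  "p permutes {..<m} \<Longrightarrow> (\<And>i. i < m \<Longrightarrow> a i ^ e = 1) \<Longrightarrow> (\<Prod>i<m. a i) = 1 \<Longrightarrow>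
   mon m p a \<in> monomials e m"
  by (auto simp: monomials_def)

lemma one_monomials: "1\<^sub>m m \<in> monomials e m"
  using monomialsI[of id m "\<lambda>_. 1" e] by (simp add: mon_id permutes_id)

lemma mult_monomials:
  assumes "g \<in> monomials e m" "h \<in> monomials e m"
  shows "g * h \<in> monomials e m"
proof -
  obtain p a where g: "g = mon m p a" "p permutes {..<m}" "\<And>i. i < m \<Longrightarrow> a i ^ e = 1"
    "(\<Prod>i<m. a i) = 1" using assms(1) by (rule monomialsE) blast
  obtain q b where h: "h = mon m q b" "q permutes {..<m}" "\<And>i. i < m \<Longrightarrow> b i ^ e = 1"
    "(\<Prod>i<m. b i) = 1" using assms(2) by (rule monomialsE) blast
  have q: "q j < m" if "j < m" for j using permutes_in_image[OF h(2)] that by auto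
  have "(\<Prod>i<m. a (q i)) = 1"
    using prod.permute[OF h(2), of a] g(4) by (simp add: o_def)
  then show ?thesis
    using g h q mon_mult[OF h(2), of p a b]
    by (auto intro!: monomialsI permutes_compose simp: power_mult_distrib prod.distrib)
qed

lemma mon_inverse:
  assumes p: "p permutes {..<m}" and a: "\<And>i. i < m \<Longrightarrow> a i \<noteq> 0"
  defines "h \<equiv> mon m (Hilbert_Choice.inv p) (\<lambda>i. inverse (a (Hilbert_Choice.inv p i)))"
  shows "h * mon m p a = 1\<^sub>m m" "mon m p a * h = 1\<^sub>m m"
proof -
  let ?q = "Hilbert_Choice.inv p"
  have q: "?q permutes {..<m}" by (rule permutes_inv[OF p])
  have less: "?q j < m" if "j < m" for j using permutes_in_image[OF q] that by auto
  show "h * mon m p a = 1\<^sub>m m"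
    unfolding h_def mon_mult[OF p] mon_id[symmetric]
    using a permutes_inverses[OF p] by (intro mon_cong) auto
  show "mon m p a * h = 1\<^sub>m m"
    unfolding h_def mon_mult[OF q] mon_id[symmetric]
    using a less permutes_inverses[OF p] by (intro mon_cong) auto
qed

lemma root_of_unity_nonzero: "(x::complex) ^ e = 1 \<Longrightarrow> e \<ge> 1 \<Longrightarrow> x \<noteq> 0"
  by (auto simp: power_0_left)

lemma monomials_inverse:
  assumes e: "e \<ge> 1" and g: "g \<in> monomials e m"
  shows "g \<in> carrier (GL m)" "inv\<^bsub>GL m\<^esub> g \<in> monomials e m"
proof -
  interpret group "GL m" by (rule group_GL)
  obtain p a where g: "g = mon m p a" and p: "p permutes {..<m}"
    and a: "\<And>i. i < m \<Longrightarrow> a i ^ e = 1" "(\<Prod>i<m. a i) = 1"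
    using assms(2) by (rule monomialsE) blast
  let ?q = "Hilbert_Choice.inv p"
  let ?h = "mon m ?q (\<lambda>i. inverse (a (?q i)))"
  have a0: "a i \<noteq> 0" if "i < m" for i using a(1)[OF that] e root_of_unity_nonzero by blast
  have q: "?q permutes {..<m}" by (rule permutes_inv[OF p])
  have less: "?q j < m" if "j < m" for j using permutes_in_image[OF q] that by auto
  show gc: "g \<in> carrier (GL m)"
    unfolding g using mon_inverse[OF p, of a] a0 by (intro GL_carrierI[of _ _ ?h]) auto
  have hc: "?h \<in> carrier (GL m)"
    using mon_inverse[OF p, of a] a0 by (intro GL_carrierI[of _ _ g]) (auto simp: g)
  have "inv\<^bsub>GL m\<^esub> g = ?h"
    using mon_inverse(1)[OF p, of a] a0 gc hc by (intro inv_equality) (auto simp: g)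
  moreover have "(\<Prod>i<m. inverse (a (?q i))) = 1"
    using prod.permute[OF q, of "\<lambda>i. inverse (a i)"] a(2) prod_inversef[of a "{..<m}"]
    by (simp add: o_def)
  ultimately show "inv\<^bsub>GL m\<^esub> g \<in> monomials e m"
    using q less a(1) by (auto intro!: monomialsI simp: power_inverse)
qed

section \<open>Generators and explicit form of the group\<close>

lemma perm_mats_monomials: "perm_mats m \<subseteq> monomials e m"
  by (auto simp: perm_mats_def mon_def[symmetric] intro!: monomialsI)

lemma diag_mats_eq:
  "diag_mats e m = {mon m id a | a. (\<forall>i<m. a i ^ e = 1) \<and> (\<Prod>i<m. a i) = 1}"
proof -
  have det: "det (mon m id a) = (\<Prod>i<m. a i)" for a
  proof -
    have "det (mon m id a) = prod_list (diag_mat (mon m id a))"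
      by (rule det_upper_triangular[of _ m]) (auto simp: mon_def)
    also have "\<dots> = (\<Prod>i<m. a i)"
      by (simp add: mon_def prod_list_diag_prod atLeast0LessThan)
    finally show ?thesis .
  qed
  have diag: "D = mon m id (\<lambda>i. D $$ (i, i))" if "D \<in> carrier_mat m m" "diagonal_mat D" for D
    using that by (intro eq_matI) (auto simp: mon_def diagonal_mat_def)
  show ?thesis
  proof (intro equalityI subsetI)
    fix D assume D: "D \<in> diag_mats e m"
    then have eq: "D = mon m id (\<lambda>i. D $$ (i, i))" by (auto simp: diag_mats_def intro: diag)
    have "(\<Prod>i<m. D $$ (i, i)) = 1"
      using D det[of "\<lambda>i. D $$ (i, i)"] eq by (simp add: diag_mats_def)
    then show "D \<in> {mon m id a | a. (\<forall>i<m. a i ^ e = 1) \<and> (\<Prod>i<m. a i) = 1}"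
      using eq D by (auto simp: diag_mats_def)
  next
    fix D assume "D \<in> {mon m id a | a. (\<forall>i<m. a i ^ e = 1) \<and> (\<Prod>i<m. a i) = 1}"
    then show "D \<in> diag_mats e m"
      by (auto simp: diag_mats_def det) (auto simp: mon_def diagonal_mat_def)
  qed
qed

text \<open>The monomial matrices contain the generators and are closed under products and inverses;
  conversely each of them is a permutation matrix times a diagonal matrix.\<close>

lemma Geen_eq_monomials:
  assumes e: "e \<ge> 1"
  shows "Geen e n = monomials e (Suc n)"
proof -
  let ?m = "Suc n"
  have gens: "perm_mats ?m \<union> diag_mats e ?m \<subseteq> monomials e ?m"
    using perm_mats_monomials by (auto simp: diag_mats_eq intro!: monomialsI permutes_id)
  have "g \<in> monomials e ?m" if "g \<in> generate (GL ?m) (perm_mats ?m \<union> diag_mats e ?m)" for g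
    using that
  proof (induction rule: generate.induct)
    case one
    then show ?case by (simp add: one_monomials)
  next
    case (eng g h)
    then show ?case by (simp add: mult_monomials)
  qed (use gens monomials_inverse[OF e] in blast)+
  moreover have "mon ?m p a \<in> generate (GL ?m) (perm_mats ?m \<union> diag_mats e ?m)"
    if p: "p permutes {..<?m}" and a: "\<forall>i<?m. a i ^ e = 1" "(\<Prod>i<?m. a i) = 1" for p a
  proof -
    have "mon ?m p (\<lambda>_. 1) \<in> perm_mats ?m"
      using p by (auto simp: perm_mats_def mon_def)
    moreover have "mon ?m id a \<in> diag_mats e ?m" using a by (auto simp: diag_mats_eq)
    ultimately have "mon ?m p (\<lambda>_. 1) \<otimes>\<^bsub>GL ?m\<^esub> mon ?m id a \<in>
        generate (GL ?m) (perm_mats ?m \<union> diag_mats e ?m)"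
      by (intro generate.eng generate.incl) auto
    then show ?thesis using mon_mult[OF permutes_id[of "{..<?m}"], of p "\<lambda>_. 1" a] by (simp add: o_def id_def)
  qed
  ultimately show ?thesis unfolding Geen_def by (auto simp: monomials_def)
qed

section \<open>Reflections\<close>

text \<open>A kernel of dimension \<open>m - 1\<close> means rank one, that is, a nonzero product of
  a column and a row. The rank is read off as the number of nonzero rows \<open>R\<close> of the
  Gauss-Jordan form \<open>?B\<close>.\<close>

lemma kernel_dim_rank_one:
  fixes A :: "'a :: field mat"
  assumes A: "A \<in> carrier_mat m m" and m: "m \<ge> 1"
  shows "kernel_dim A = m - 1 \<longleftrightarrow>
    (\<exists>x y. \<forall>i<m. \<forall>j<m. A $$ (i, j) = x i * y j) \<and> A \<noteq> 0\<^sub>m m m"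
proof -
  let ?B = "gauss_jordan_single A"
  obtain P Q where B: "?B = P * A" and QP: "Q * P = 1\<^sub>m m"
    and P: "P \<in> carrier_mat m m" and Q: "Q \<in> carrier_mat m m" and Bc: "?B \<in> carrier_mat m m"
    and row: "row_echelon_form ?B"
    using gauss_jordan_single[OF A HOL.refl] by blast
  define R where "R = {i. i < m \<and> row ?B i \<noteq> 0\<^sub>v m}"
  have finR: "finite R" by (simp add: R_def)
  have "card R \<le> m"
    using card_mono[of "{..<m}" R] by (auto simp: R_def)
  moreover have "kernel_dim A = m - card R"
  proof -
    interpret K: kernel m m ?B by (unfold_locales, rule Bc)
    have "kernel_dim A = K.dim"
      using mat_kernel_mult_eq[OF A P Q QP] A by (simp add: kernel_dim_def B)
    also have "\<dots> = m - card R" unfolding R_def by (rule find_base_vectors(6)[OF row Bc])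
    finally show ?thesis .
  qed
  \<comment> \<open>Both \<open>card R \<le> m\<close> and \<open>m \<ge> 1\<close> enter here,
    because subtraction of naturals is truncated.\<close>
  ultimately have dim: "kernel_dim A = m - 1 \<longleftrightarrow> card R = 1" using m by auto
  have QB: "A = Q * ?B"
    using assoc_mult_mat[OF Q P A] by (simp add: B QP left_mult_one_mat[OF A])
  show ?thesis
  proof
    assume "kernel_dim A = m - 1"
    then have "card R = 1" using dim by simp
    then obtain r where r: "R = {r}" by (auto simp: card_1_singleton_iff)
    have rm: "r < m" using r by (auto simp: R_def)
    have zero: "?B $$ (l, j) = 0" if "l < m" "j < m" "l \<noteq> r" for l j
    proof -
      have "row ?B l = 0\<^sub>v m" using that r by (auto simp: R_def)
      then show ?thesis using that Bc by (metis carrier_matD index_row(1) index_zero_vec(1))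
    qed
    \<comment> \<open>Only row \<open>r\<close> of \<open>?B\<close> survives in
      \<open>A = Q * ?B\<close>.\<close>
    have "A $$ (i, j) = Q $$ (i, r) * ?B $$ (r, j)" if "i < m" "j < m" for i j
    proof -
      have "A $$ (i, j) = (\<Sum>l<m. Q $$ (i, l) * ?B $$ (l, j))"
        by (subst QB) (use that Q Bc in \<open>simp add: scalar_prod_def atLeast0LessThan\<close>)
      also have "\<dots> = (\<Sum>l<m. if l = r then Q $$ (i, r) * ?B $$ (r, j) else 0)"
        using that zero by (intro sum.cong) auto
      finally show ?thesis using rm by simp
    qed
    moreover have "A \<noteq> 0\<^sub>m m m"
    proof
      assume "A = 0\<^sub>m m m"
      then have "?B = 0\<^sub>m m m" using B P by simp
      then have "row ?B r = 0\<^sub>v m" using rm by auto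
      then show False using r by (auto simp: R_def)
    qed
    ultimately show "(\<exists>x y. \<forall>i<m. \<forall>j<m. A $$ (i, j) = x i * y j) \<and> A \<noteq> 0\<^sub>m m m"
      by (intro conjI exI[of _ "\<lambda>i. Q $$ (i, r)"] exI[of _ "\<lambda>j. ?B $$ (r, j)"]) auto
  next
    assume "(\<exists>x y. \<forall>i<m. \<forall>j<m. A $$ (i, j) = x i * y j) \<and> A \<noteq> 0\<^sub>m m m"
    then obtain x y where xy: "\<And>i j. i < m \<Longrightarrow> j < m \<Longrightarrow> A $$ (i, j) = x i * y j"
      and A0: "A \<noteq> 0\<^sub>m m m" by auto
    define z where "z i = (\<Sum>l<m. P $$ (i, l) * x l)" for i
    have Bz: "?B $$ (i, j) = z i * y j" if "i < m" "j < m" for i j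
      unfolding B using that P A xy
      by (simp add: scalar_prod_def atLeast0LessThan z_def sum_distrib_right mult.assoc)
    obtain f where f: "pivot_fun ?B f m"
      using row Bc by (auto simp: row_echelon_form_def)
    have pivot: "f i < m \<and> ?B $$ (i, f i) = 1 \<and> (\<forall>i'<m. i' \<noteq> i \<longrightarrow> ?B $$ (i', f i) = 0)"
      if "i \<in> R" for i
    proof -
      have i: "i < m" "row ?B i \<noteq> 0\<^sub>v m" using that by (auto simp: R_def)
      have "f i \<noteq> m"
      proof
        assume "f i = m"
        then have "\<forall>j<m. ?B $$ (i, j) = 0" using pivot_funD(2)[OF _ f, of m i] Bc i by auto
        then have "row ?B i = 0\<^sub>v m" using Bc i by (intro eq_vecI) auto
        then show False using i by simp
      qed
      then have "f i < m" using pivot_funD(1)[OF _ f, of m i] Bc i by auto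
      then show ?thesis
        using pivot_funD(4,5)[OF _ f, of m i] Bc i by auto
    qed
    have "R \<noteq> {}"
    proof
      assume "R = {}"
      then have "?B $$ (i, j) = 0" if "i < m" "j < m" for i j
        using that Bc by (auto simp: R_def) (metis carrier_matD index_row(1) index_zero_vec(1))
      then have "?B = 0\<^sub>m m m" using Bc by (intro eq_matI) auto
      then have "A = 0\<^sub>m m m" using QB Q by simp
      then show False using A0 by simp
    qed
    moreover have "i = j" if ij: "i \<in> R" "j \<in> R" for i j
    proof (rule ccontr)
      \<comment> \<open>Two distinct pivot rows yield a 2 by 2 minor equal to one, whereas all such
        minors of \<open>z i * y j\<close> vanish.\<close>
      assume "i \<noteq> j"
      then have "?B $$ (i, f i) * ?B $$ (j, f j) = 1" "?B $$ (i, f j) * ?B $$ (j, f i) = 0"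
        using pivot[OF ij(1)] pivot[OF ij(2)] ij by (auto simp: R_def)
      moreover have "?B $$ (i, f i) * ?B $$ (j, f j) = ?B $$ (i, f j) * ?B $$ (j, f i)"
      proof -
        have "i < m" "j < m" "f i < m" "f j < m"
          using pivot[OF ij(1)] pivot[OF ij(2)] ij by (auto simp: R_def)
        then show ?thesis by (simp only: Bz mult_ac)
      qed
      ultimately show False by simp
    qed
    ultimately have "card R = 1" by (metis card_1_singleton_iff One_nat_def is_singletonI' is_singleton_def)
    then show "kernel_dim A = m - 1" using dim by simp
  qed
qed

text \<open>Combined with the transposition of \<open>i\<close> and \<open>j\<close> these
  coefficients give a reflection; combined with the identity they give the diagonal product of two
  reflections along one edge.\<close>

definition swap_phase :: "nat \<Rightarrow> nat \<Rightarrow> complex \<Rightarrow> nat \<Rightarrow> complex" where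
  "swap_phase i j u = (\<lambda>k. if k = i then u else if k = j then inverse u else 1)"

text \<open>The reflection \<open>swp m i j u\<close> sends \<open>e\<^sub>i\<close> to \<open>u\<close> times \<open>e\<^sub>j\<close> and back.\<close>

definition swp :: "nat \<Rightarrow> nat \<Rightarrow> nat \<Rightarrow> complex \<Rightarrow> complex mat" where
  "swp m i j u = mon m (transpose i j) (swap_phase i j u)"

definition swps :: "nat \<Rightarrow> nat \<Rightarrow> complex mat set" where
  "swps e m = {swp m i j u | i j u. i < m \<and> j < m \<and> i \<noteq> j \<and> u ^ e = 1}"

lemma swpsE:
  assumes "t \<in> swps e m"
  obtains i j u where "t = swp m i j u" "i < m" "j < m" "i \<noteq> j" "u ^ e = 1"
  using assms by (auto simp: swps_def)

lemma swpsI: "i < m \<Longrightarrow> j < m \<Longrightarrow> i \<noteq> j \<Longrightarrow> u ^ e = 1 \<Longrightarrow> swp m i j u \<in> swps e m"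
  by (auto simp: swps_def)

lemma transpose_permutes_lessThan: "i < m \<Longrightarrow> j < m \<Longrightarrow> transpose i j permutes {..<m::nat}"
  by (rule permutes_swap_id) auto

text \<open>The factors \<open>u\<close> and \<open>inverse u\<close> occur together or not at all.
  With all indices in \<open>A\<close> this gives membership in the group, with fewer the weight of
  a block that the edge does not leave.\<close>

lemma prod_swap_phase:
  assumes "finite A" "i \<noteq> j" "u \<noteq> 0" "i \<in> A \<longleftrightarrow> j \<in> A"
  shows "(\<Prod>k\<in>A. swap_phase i j u k) = 1"
proof (cases "i \<in> A")
  case True
  have "(\<Prod>k\<in>A. swap_phase i j u k) = (\<Prod>k\<in>{i, j}. swap_phase i j u k)"
    using assms True by (intro prod.mono_neutral_right) (auto simp: swap_phase_def)
  then show ?thesis using assms by (simp add: swap_phase_def)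
next
  case False
  then have "(\<Prod>k\<in>A. swap_phase i j u k) = (\<Prod>k\<in>A. 1)"
    using assms by (intro prod.cong) (auto simp: swap_phase_def)
  then show ?thesis by simp
qed

lemma swps_monomials:
  assumes e: "e \<ge> 1"
  shows "swps e m \<subseteq> monomials e m"
proof
  fix t assume "t \<in> swps e m"
  then obtain i j u where t: "t = swp m i j u" "i < m" "j < m" "i \<noteq> j" "u ^ e = 1"
    by (rule swpsE)
  then show "t \<in> monomials e m"
    using prod_swap_phase[of "{..<m}" i j u] root_of_unity_nonzero[OF t(5) e]
    by (auto simp: swp_def swap_phase_def power_inverse intro!: monomialsI transpose_permutes_lessThan)
qed

lemma swp_of_mon:
  assumes "i \<noteq> j" "i < m" "j < m" "p i = j" "p j = i" "a i * a j = 1"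
    and "\<And>k. k < m \<Longrightarrow> k \<noteq> i \<Longrightarrow> k \<noteq> j \<Longrightarrow> p k = k \<and> a k = 1"
  shows "mon m p a = swp m i j (a i)"
  unfolding swp_def
proof (rule mon_cong)
  have "a j = inverse (a i)" using assms(6) by (metis inverse_unique)
  then show "a k = swap_phase i j (a i) k" if "k < m" for k
    using assms that by (auto simp: swap_phase_def)
  show "p k = transpose i j k" if "k < m" for k
    using assms that by (auto simp: transpose_def)
qed

lemma swp_kernel_dim:
  assumes "i < m" "j < m" "i \<noteq> j" "u \<noteq> 0"
  shows "kernel_dim (swp m i j u - 1\<^sub>m m) = m - 1"
proof -
  let ?A = "swp m i j u - 1\<^sub>m m"
  \<comment> \<open>\<open>?x\<close> is the image of \<open>e_i\<close> under \<open>?A\<close>,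
    and the image of \<open>e_j\<close> is \<open>- inverse u\<close> times
    \<open>?x\<close>.\<close>
  let ?x = "\<lambda>k. if k = i then - 1 else if k = j then u else 0"
  let ?y = "\<lambda>k. if k = i then 1 else if k = j then - inverse u else 0"
  have "?A $$ (k, l) = ?x k * ?y l" if "k < m" "l < m" for k l
    using that assms by (auto simp: swp_def mon_def transpose_def swap_phase_def)
  moreover have "?A \<noteq> 0\<^sub>m m m"
  proof
    assume "?A = 0\<^sub>m m m"
    then have "?A $$ (i, i) = 0" using assms by simp
    then show False using assms by (simp add: swp_def mon_def transpose_def)
  qed
  ultimately have "(\<exists>x y. \<forall>k<m. \<forall>l<m. ?A $$ (k, l) = x k * y l) \<and> ?A \<noteq> 0\<^sub>m m m"
    by (intro conjI exI[of _ ?x] exI[of _ ?y]) auto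
  moreover have "?A \<in> carrier_mat m m" by (simp add: minus_carrier_mat)
  ultimately show ?thesis using assms by (subst kernel_dim_rank_one) auto
qed

text \<open>All 2 by 2 minors of \<open>t - 1\<close> vanish. If \<open>p\<close> moves
  \<open>i\<close>, the diagonal entry \<open>- 1\<close> at \<open>i\<close> forces every
  coordinate other than \<open>i\<close> and \<open>p i\<close> to be fixed with coefficient one. If
  \<open>p\<close> is the identity, only one coefficient can differ from one, which the product
  condition excludes.\<close>

lemma monomial_reflection:
  assumes e: "e \<ge> 1" and m: "m \<ge> 1" and t: "t \<in> monomials e m"
    and dim: "kernel_dim (t - 1\<^sub>m m) = m - 1"
  shows "t \<in> swps e m"
proof -
  let ?A = "t - 1\<^sub>m m"
  obtain p a where t: "t = mon m p a" and p: "p permutes {..<m}"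
    and a: "\<And>i. i < m \<Longrightarrow> a i ^ e = 1" "(\<Prod>i<m. a i) = 1"
    using t by (rule monomialsE) blast
  have a0: "a i \<noteq> 0" if "i < m" for i using a(1)[OF that] e root_of_unity_nonzero by blast
  have less: "p j < m" if "j < m" for j using permutes_in_image[OF p] that by auto
  have Ac: "?A \<in> carrier_mat m m" by (simp add: minus_carrier_mat)
  have A: "?A $$ (i, j) = (if i = p j then a j else 0) - (if i = j then 1 else 0)"
    if "i < m" "j < m" for i j using that by (simp add: t mon_def)
  obtain x y where xy: "\<And>i j. i < m \<Longrightarrow> j < m \<Longrightarrow> ?A $$ (i, j) = x i * y j" and A0: "?A \<noteq> 0\<^sub>m m m"
    using kernel_dim_rank_one[OF Ac m] dim by blast
  have minor: "?A $$ (i, j) * ?A $$ (k, l) = ?A $$ (i, l) * ?A $$ (k, j)"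
    if "i < m" "j < m" "k < m" "l < m" for i j k l by (simp only: xy that mult_ac)
  show ?thesis
  proof (cases "\<exists>i<m. p i \<noteq> i")
    case True
    then obtain i where i: "i < m" "p i \<noteq> i" by blast
    define j where "j = p i"
    have j: "j < m" "j \<noteq> i" "p i = j" using i less by (auto simp: j_def)
    have fix_k: "p k = k \<and> a k = 1" if k: "k < m" "k \<noteq> i" "k \<noteq> j" for k
    proof -
      have "?A $$ (i, i) * ?A $$ (k, k) = ?A $$ (i, k) * ?A $$ (k, i)"
        using i k by (intro minor) auto
      moreover have "?A $$ (k, i) = 0" "?A $$ (i, i) = - 1" using A i j k by auto
      ultimately have "?A $$ (k, k) = 0" by simp
      then show ?thesis using A[of k k] k by (auto split: if_splits)
    qed
    have "p j = i"
    proof (rule ccontr)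
      \<comment> \<open>Otherwise \<open>p j\<close> is a third coordinate, which \<open>p\<close>
        fixes, against injectivity.\<close>
      assume ne: "p j \<noteq> i"
      have "p j \<noteq> j" using permutes_inj[OF p] j by (metis injD)
      then have "p (p j) = p j" using fix_k[OF less[OF j(1)] ne] by auto
      then have "p j = j" using permutes_inj[OF p] by (metis injD)
      then show False using \<open>p j \<noteq> j\<close> by simp
    qed
    \<comment> \<open>The minor on rows and columns \<open>i\<close> and \<open>j\<close> compares
      \<open>(- 1) * (- 1)\<close> with \<open>a i * a j\<close>.\<close>
    moreover have "a i * a j = 1"
      using minor[of i i j j] A i j \<open>p j = i\<close> by (auto simp: mult.commute)
    ultimately have "t = swp m i j (a i)"
      unfolding t using i j fix_k by (intro swp_of_mon) auto
    then show ?thesis using i j a(1) by (auto intro: swpsI)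
  next
    case False
    then have id: "\<And>i. i < m \<Longrightarrow> p i = i" by blast
    have off: "?A $$ (i, j) = 0" if "i < m" "j < m" "i \<noteq> j" for i j
      using A that id by auto
    then obtain i where i: "i < m" "?A $$ (i, i) \<noteq> 0"
      using A0 Ac by (metis (no_types, lifting) carrier_matD eq_matI index_zero_mat)
    have "a k = 1" if k: "k < m" "k \<noteq> i" for k
      using minor[of i i k k] off[of i k] A[of k k] id i k by auto
    then have "(\<Prod>k<m. a k) = a i"
      using i by (subst prod.remove[of _ i]) auto
    then show ?thesis using a(2) i A[of i i] id by auto
  qed
qed

lemma reflections_eq_swps:
  assumes e: "e \<ge> 1"
  shows "reflections e n = swps e (Suc n)"
proof (intro equalityI subsetI)
  fix t assume "t \<in> reflections e n"
  then show "t \<in> swps e (Suc n)"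
    by (auto simp: reflections_def Geen_eq_monomials[OF e] intro!: monomial_reflection[OF e])
next
  fix t assume t: "t \<in> swps e (Suc n)"
  then obtain i j u where "t = swp (Suc n) i j u" "i < Suc n" "j < Suc n" "i \<noteq> j" "u ^ e = 1"
    by (rule swpsE)
  then have "kernel_dim (t - 1\<^sub>m (Suc n)) = n"
    using swp_kernel_dim[of i "Suc n" j u] root_of_unity_nonzero[OF _ e, of u] by simp
  then show "t \<in> reflections e n"
    using t swps_monomials[OF e] by (auto simp: reflections_def Geen_eq_monomials[OF e])
qed

section \<open>Straightening reduced decompositions\<close>

lemma mon_unit_vector:
  assumes "mon m p a = mon m q b" "p permutes {..<m}" "q permutes {..<m}"
    "\<And>j. j < m \<Longrightarrow> a j \<noteq> 0" "k < m"
  shows "p k = q k" "a k = b k"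
  using mon_inject[OF assms(1-4)] assms(5) by auto

lemma swp_carrier_mat [simp]: "swp m i j u \<in> carrier_mat m m"
  by (simp add: swp_def)

lemma swp_commute:
  assumes "i \<noteq> j"
  shows "swp m i j u = swp m j i (inverse u)"
  unfolding swp_def using assms
  by (intro mon_cong) (auto simp: transpose_commute swap_phase_def)

text \<open>The monomial matrix maps \<open>e_i / a i\<close> to \<open>e_(p i)\<close>, so
  conjugation carries the edge \<open>{i, j}\<close> to \<open>{p i, p j}\<close> and multiplies the
  phase by \<open>a j / a i\<close>. As a commutation rule this involves no inverse matrix.\<close>

lemma mon_swp_commute:
  assumes p: "p permutes {..<m}" and a: "\<And>k. k < m \<Longrightarrow> a k \<noteq> 0"
    and ij: "i < m" "j < m" "i \<noteq> j"
  shows "mon m p a * swp m i j u = swp m (p i) (p j) (u * a j / a i) * mon m p a"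
proof -
  have inj: "p x = p y \<longleftrightarrow> x = y" for x y using permutes_inj[OF p] by (auto dest: injD)
  have "p \<circ> transpose i j = transpose (p i) (p j) \<circ> p"
    by (auto simp: fun_eq_iff transpose_def inj)
  then show ?thesis
    unfolding swp_def mon_mult[OF p] mon_mult[OF transpose_permutes_lessThan[OF ij(1,2)]]
    using a ij by (intro mon_cong) (auto simp: swap_phase_def inj fun_eq_iff divide_inverse)
qed

text \<open>Only the ratio of the two phases survives, so different pairs of reflections along one
  edge can share a product.\<close>

lemma swp_mult_same:
  assumes "i < m" "j < m" "i \<noteq> j" "u \<noteq> 0" "v \<noteq> 0"
  shows "swp m i j u * swp m i j v = mon m id (swap_phase i j (v / u))"
  unfolding swp_def mon_mult[OF transpose_permutes_lessThan[OF assms(1,2)]]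
  using assms by (intro mon_cong) (auto simp: swap_phase_def divide_inverse mult.commute)

lemma swp_mult_phase:
  assumes "i < m" "j < m" "i \<noteq> j"
  shows "swp m i j u * mon m id (swap_phase i j v) = swp m i j (u * v)"
  unfolding swp_def mon_mult[OF permutes_id]
  using assms by (intro mon_cong) (auto simp: swap_phase_def)

lemma swp_mult_self:
  assumes "i < m" "j < m" "i \<noteq> j" "u \<noteq> 0"
  shows "swp m i j u * swp m i j u = 1\<^sub>m m"
  unfolding swp_mult_same[OF assms(1-3) assms(4) assms(4)] mon_id[symmetric]
  using assms by (intro mon_cong) (auto simp: swap_phase_def)

section \<open>Reduced lists of reflections\<close>

locale root_of_unity_swaps =
  fixes e m :: nat
  assumes e: "e \<ge> 1"
begin

sublocale G: group "GL m" by (rule group_GL)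

abbreviation prods :: "complex mat list \<Rightarrow> complex mat" where
  "prods \<equiv> prod_list_in (GL m)"

abbreviation hequiv :: "complex mat list \<Rightarrow> complex mat list \<Rightarrow> bool" where
  "hequiv \<equiv> hurwitz_equiv (GL m)"

text \<open>Membership in \<open>Red_T\<close> of the list's own product; factors and transformed
  lists are thus treated without naming an element.\<close>

definition reduced :: "complex mat list \<Rightarrow> bool" where
  "reduced ts \<longleftrightarrow> set ts \<subseteq> swps e m \<and>
     (\<forall>us. set us \<subseteq> swps e m \<longrightarrow> prods us = prods ts \<longrightarrow> length ts \<le> length us)"

lemma swps_carrier: "swps e m \<subseteq> carrier (GL m)"
  using swps_monomials[OF e] monomials_inverse[OF e] by blast

lemma set_swps_carrier: "set ts \<subseteq> swps e m \<Longrightarrow> set ts \<subseteq> carrier (GL m)"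
  using swps_carrier by blast

lemma phase_nonzero: "u ^ e = 1 \<Longrightarrow> u \<noteq> (0::complex)"
  using e root_of_unity_nonzero by blast

lemma inv_swp:
  assumes t: "t \<in> swps e m"
  shows "inv\<^bsub>GL m\<^esub> t = t"
proof (rule G.inv_equality)
  show "t \<otimes>\<^bsub>GL m\<^esub> t = \<one>\<^bsub>GL m\<^esub>"
    using t swp_mult_self phase_nonzero by (auto elim!: swpsE)
qed (use t swps_carrier in auto)

lemma conj_swp:
  assumes p: "p permutes {..<m}" and a: "\<And>k. k < m \<Longrightarrow> a k \<noteq> 0"
    and g: "mon m p a \<in> carrier (GL m)"
    and ij: "i < m" "j < m" "i \<noteq> j" and u: "u ^ e = 1" and w: "(u * a j / a i) ^ e = 1"
  shows "mon m p a \<otimes>\<^bsub>GL m\<^esub> swp m i j u \<otimes>\<^bsub>GL m\<^esub> inv\<^bsub>GL m\<^esub> (mon m p a)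
    = swp m (p i) (p j) (u * a j / a i)"
proof -
  let ?w = "u * a j / a i"
  have "p i < m" "p j < m" "p i \<noteq> p j"
    using permutes_in_image[OF p] ij permutes_inj[OF p] by (auto dest: injD)
  then have c: "swp m (p i) (p j) ?w \<in> carrier (GL m)"
    using w swpsI swps_carrier by blast
  have "mon m p a \<otimes>\<^bsub>GL m\<^esub> swp m i j u = swp m (p i) (p j) ?w \<otimes>\<^bsub>GL m\<^esub> mon m p a"
    using mon_swp_commute[where a = a and u = u, OF p a ij] by simp
  then show ?thesis using c g by (metis G.inv_closed G.m_assoc G.r_inv G.r_one)
qed

lemma conj_swps:
  assumes t: "t \<in> swps e m" and s: "s \<in> swps e m"
  shows "t \<otimes>\<^bsub>GL m\<^esub> s \<otimes>\<^bsub>GL m\<^esub> inv\<^bsub>GL m\<^esub> t \<in> swps e m"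
proof -
  have "t \<in> monomials e m" using t swps_monomials[OF e] by blast
  then obtain p a where g: "t = mon m p a" "p permutes {..<m}" "\<And>i. i < m \<Longrightarrow> a i ^ e = 1"
    by (rule monomialsE) blast
  obtain i j u where s: "s = swp m i j u" and ij: "i < m" "j < m" "i \<noteq> j" and u: "u ^ e = 1"
    using s by (rule swpsE)
  have w: "(u * a j / a i) ^ e = 1" using g ij u by (simp add: power_mult_distrib power_divide)
  have "p i < m" "p j < m" "p i \<noteq> p j"
    using permutes_in_image[OF g(2)] ij permutes_inj[OF g(2)] by (auto dest: injD)
  then show ?thesis
    using conj_swp[OF g(2), of a i j u] t swps_carrier phase_nonzero g ij u w
    by (auto simp: s intro!: swpsI)
qed

lemma hequiv_swps: "hequiv us vs \<Longrightarrow> set us \<subseteq> swps e m \<longleftrightarrow> set vs \<subseteq> swps e m"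
proof (rule G.hurwitz_equiv_set[OF swps_carrier])
  show "t \<otimes>\<^bsub>GL m\<^esub> s \<otimes>\<^bsub>GL m\<^esub> inv\<^bsub>GL m\<^esub> t \<in> swps e m" if "t \<in> swps e m" "s \<in> swps e m" for t s
    using that by (rule conj_swps)
  then show "inv\<^bsub>GL m\<^esub> t \<otimes>\<^bsub>GL m\<^esub> s \<otimes>\<^bsub>GL m\<^esub> t \<in> swps e m" if "t \<in> swps e m" "s \<in> swps e m" for t s
    using that inv_swp[OF that(1)] by metis
qed

lemma hequiv_prods: "hequiv us vs \<Longrightarrow> set us \<subseteq> swps e m \<Longrightarrow> prods us = prods vs"
  using G.hurwitz_equiv_prod set_swps_carrier by blast

lemma hequiv_reduced:
  assumes "hequiv us vs" "reduced us"
  shows "reduced vs"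
  using assms hequiv_swps[OF assms(1)] hequiv_prods[OF assms(1)] hurwitz_equiv_length[OF assms(1)]
  unfolding reduced_def by metis

lemma prods_monomials: "set ts \<subseteq> swps e m \<Longrightarrow> prods ts \<in> monomials e m"
proof (induction ts)
  case Nil
  then show ?case by (simp add: one_monomials)
next
  case (Cons t ts)
  then have "t \<in> monomials e m" using swps_monomials[OF e] by auto
  then show ?case using Cons by (simp add: mult_monomials)
qed

lemma prods_append:
  "set us \<subseteq> swps e m \<Longrightarrow> set vs \<subseteq> swps e m \<Longrightarrow> prods (us @ vs) = prods us * prods vs"
  using G.prod_list_in_append[of us vs] set_swps_carrier by simp

lemma prods_carrier: "set ts \<subseteq> swps e m \<Longrightarrow> prods ts \<in> carrier (GL m)"
  using G.prod_list_in_closed set_swps_carrier by blast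

lemma prods_factor:
  assumes "set us \<subseteq> swps e m" "set ts \<subseteq> swps e m" "set ts' \<subseteq> swps e m" "set vs \<subseteq> swps e m"
    "prods ts = prods ts'"
  shows "prods (us @ ts @ vs) = prods (us @ ts' @ vs)"
  using assms by (simp add: prods_append)

text \<open>A shorter decomposition of the factor could be substituted into the whole list.\<close>

lemma reduced_factor:
  assumes "reduced (us @ ts @ vs)"
  shows "reduced ts"
  unfolding reduced_def
proof (intro conjI allI impI)
  have s: "set us \<subseteq> swps e m" "set ts \<subseteq> swps e m" "set vs \<subseteq> swps e m"
    using assms by (auto simp: reduced_def)
  show "set ts \<subseteq> swps e m" by (rule s)
  fix ts' assume ts': "set ts' \<subseteq> swps e m" "prods ts' = prods ts"
  have "set (us @ ts' @ vs) \<subseteq> swps e m" using s ts' by simp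
  moreover have "prods (us @ ts' @ vs) = prods (us @ ts @ vs)"
    using prods_factor[OF s(1) ts'(1) s(2,3) ts'(2)] .
  ultimately have "length (us @ ts @ vs) \<le> length (us @ ts' @ vs)"
    using assms unfolding reduced_def by blast
  then show "length ts \<le> length ts'" by simp
qed

text \<open>The action on the line of \<open>e_k\<close> decides how a reflection interacts with the
  others; in the moving case the edge is oriented to start at \<open>k\<close>.\<close>

lemma swps_cases:
  assumes t: "t \<in> swps e m" and k: "k < m"
  obtains (fixes_line) q b where "t = mon m q b" "q permutes {..<m}" "\<And>i. i < m \<Longrightarrow> b i ^ e = 1"
      "q k = k" "b k = 1"
  | (moves_line) l u where "t = swp m k l u" "l < m" "l \<noteq> k" "u ^ e = 1"
proof -
  obtain i j u where t: "t = swp m i j u" and ij: "i < m" "j < m" "i \<noteq> j" and u: "u ^ e = 1"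
    using t by (rule swpsE)
  consider "k = i" | "k = j" | "k \<noteq> i" "k \<noteq> j" by blast
  then show thesis
  proof cases
    case 1
    then show thesis using moves_line[of j u] t ij u by simp
  next
    case 2
    then show thesis
      using moves_line[of i "inverse u"] t ij u swp_commute[of i j m u] by (simp add: power_inverse)
  next
    case 3
    then show thesis
      using fixes_line[of "transpose i j" "swap_phase i j u"] t ij u
      by (simp add: swp_def transpose_permutes_lessThan swap_phase_def power_inverse)
  qed
qed

lemma swp_eq_mon: "swp m i j u = mon m (transpose i j) (swap_phase i j u)"
  by (simp add: swp_def)

lemma conj_swp_swp:
  assumes xy: "x < m" "y < m" "x \<noteq> y" and w: "w ^ e = 1"
    and ij: "i < m" "j < m" "i \<noteq> j" and u: "u ^ e = 1"
  shows "swp m x y w \<otimes>\<^bsub>GL m\<^esub> swp m i j u \<otimes>\<^bsub>GL m\<^esub> inv\<^bsub>GL m\<^esub> (swp m x y w) =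
    swp m (transpose x y i) (transpose x y j) (u * swap_phase x y w j / swap_phase x y w i)"
proof -
  have "swp m x y w \<in> carrier (GL m)" using xy w swpsI swps_carrier by blast
  moreover have "swap_phase x y w k ^ e = 1" for k
    using w by (simp add: swap_phase_def power_inverse)
  ultimately show ?thesis
    unfolding swp_eq_mon[of x y] using xy ij u phase_nonzero
    by (intro conj_swp transpose_permutes_lessThan) (auto simp: power_mult_distrib power_divide)
qed

lemma hequiv_move:
  assumes "s \<in> swps e m" "t \<in> swps e m"
  shows "hequiv (us @ s # t # vs) (us @ (s \<otimes>\<^bsub>GL m\<^esub> t \<otimes>\<^bsub>GL m\<^esub> inv\<^bsub>GL m\<^esub> s) # s # vs)"
  using assms swps_carrier by (intro hurwitz_equiv.move) auto

lemma hequiv_back: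
  assumes "s \<in> swps e m" "t \<in> swps e m"
  shows "\<exists>t'. hequiv (us @ s # t # vs) (us @ t # t' # vs)"
  using assms swps_carrier G.hurwitz_equiv_back[of s t us vs] by blast

text \<open>The two claims feed each other in the induction: a walk from \<open>k\<close> to \<open>j\<close> and back leaves a
  double edge, and a later edge out of \<open>k\<close> absorbs a double edge at \<open>k\<close>.\<close>

lemma straighten:
  assumes "reduced ts" "prods ts = mon m p a" "p permutes {..<m}"
    "\<And>i. i < m \<Longrightarrow> a i \<noteq> 0" "k < m"
  shows "(p k \<noteq> k \<longrightarrow> (\<exists>us. hequiv ts (swp m k (p k) (a k) # us))) \<and>
    (p k = k \<longrightarrow> a k \<noteq> 1 \<longrightarrow> (\<exists>l u us. l < m \<and> l \<noteq> k \<and> u ^ e = 1 \<and>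
       hequiv ts (swp m k l u # swp m k l (a k * u) # us)))"
  using assms(1-4)
proof (induction ts arbitrary: p a)
  case Nil
  have "mon m p a = mon m id (\<lambda>_. 1)" using Nil(2) by (simp add: mon_id)
  then have "p k = k" "a k = 1"
    using mon_unit_vector[OF _ Nil(3) permutes_id Nil(4) assms(5)] by (auto simp: id_def)
  then show ?case by simp
next
  case (Cons t ts)
  have red: "reduced ts" using reduced_factor[of "[t]" ts "[]"] Cons.prems by simp
  have t: "t \<in> swps e m" and ts: "set ts \<subseteq> swps e m" using Cons.prems by (auto simp: reduced_def)
  obtain p' a' where g': "prods ts = mon m p' a'" "p' permutes {..<m}"
      "\<And>i. i < m \<Longrightarrow> a' i ^ e = 1"
    using prods_monomials[OF ts] by (rule monomialsE) blast
  have a': "\<And>i. i < m \<Longrightarrow> a' i \<noteq> 0" using g' phase_nonzero by blast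
  note IH = Cons.IH[OF red g'(1,2) a']
  have pk: "p k = q (p' k) \<and> a k = b (p' k) * a' k" if "t = mon m q b" "q permutes {..<m}" for q b
  proof -
    have "mon m p a = mon m (q \<circ> p') (\<lambda>j. b (p' j) * a' j)"
      using Cons.prems(2) that g' mon_mult[OF g'(2), of q b a'] by simp
    then show ?thesis
      using mon_unit_vector[OF _ Cons.prems(3) permutes_compose[OF g'(2) that(2)] Cons.prems(4) assms(5)]
      by auto
  qed
  have pk_swp: "p k = transpose i j (p' k) \<and> a k = swap_phase i j u (p' k) * a' k"
    if "t = swp m i j u" "i < m" "j < m" for i j u
    using pk[of "transpose i j" "swap_phase i j u"] that
    by (simp add: swp_def transpose_permutes_lessThan)
  show ?case
  proof (cases "p' k = k")
    case False
    \<comment> \<open>The tail already moves the line of \<open>e_k\<close> to that of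
      \<open>e_j\<close>, so by induction it can be made to start with \<open>?s\<close>.\<close>
    define j where "j = p' k"
    have j: "j < m" "j \<noteq> k" using False permutes_in_image[OF g'(2), of k] assms(5) by (auto simp: j_def)
    let ?s = "swp m k j (a' k)"
    obtain us where us: "hequiv ts (?s # us)" using IH False j_def by blast
    have s: "?s \<in> swps e m" using j assms(5) g'(3) by (auto intro: swpsI)
    have tus: "hequiv (t # ts) (t # ?s # us)" using us by (rule hurwitz_equiv_Cons)
    from t j(1) show ?thesis
    proof (cases rule: swps_cases)
      \<comment> \<open>\<open>t\<close> fixes \<open>e_j\<close>, and the unchanged
        \<open>?s\<close> passes in front of it.\<close>
      case (fixes_line q b)
      then have "p k = j" "a k = a' k" using pk by (auto simp: j_def)
      moreover obtain t' where "hequiv (t # ?s # us) (?s # t' # us)"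
        using hequiv_back[OF t s, of "[]"] by auto
      ultimately show ?thesis using hurwitz_equiv.trans[OF tus] j by auto
    next
      case (moves_line l w)
      then have *: "p k = l" "a k = w * a' k"
        using pk_swp j by (auto simp: j_def swap_phase_def)
      show ?thesis
      proof (cases "l = k")
        \<comment> \<open>\<open>t\<close> leads back from \<open>j\<close> to \<open>k\<close>, so
          \<open>t\<close> and \<open>?s\<close> form the double edge of the second claim.\<close>
        case True
        then have "t = swp m k j (inverse w)"
          using moves_line swp_commute by metis
        moreover have "a k * inverse w = a' k" using * moves_line phase_nonzero by simp
        ultimately have "hequiv (t # ts) (swp m k j (inverse w) # swp m k j (a k * inverse w) # us)"
          using tus by (simp only:)
        moreover have "inverse w ^ e = 1" using moves_line by (simp add: power_inverse)
        ultimately show ?thesis using * True j by blast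
      next
        case False
        \<comment> \<open>Conjugation by \<open>t\<close> replaces the end \<open>j\<close> of the
          edge \<open>{k, j}\<close> by \<open>l\<close>.\<close>
        have "t \<otimes>\<^bsub>GL m\<^esub> ?s \<otimes>\<^bsub>GL m\<^esub> inv\<^bsub>GL m\<^esub> t = swp m k l (a' k * w)"
          using conj_swp_swp[of j l w k j "a' k"] moves_line j assms(5) g'(3) False
          by (simp add: swap_phase_def transpose_def)
        then have "hequiv (t # ?s # us) (swp m k (p k) (a k) # t # us)"
          using hequiv_move[OF t s, of "[]" us] * by (simp add: mult.commute)
        then show ?thesis using hurwitz_equiv.trans[OF tus] * False by auto
      qed
    qed
  next
    case True
    from t assms(5) show ?thesis
    proof (cases rule: swps_cases)
      case (fixes_line q b)
      then have *: "p k = k" "a k = a' k" using pk True by auto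
      have "\<exists>l u us. l < m \<and> l \<noteq> k \<and> u ^ e = 1 \<and>
          hequiv (t # ts) (swp m k l u # swp m k l (a k * u) # us)" if ak: "a k \<noteq> 1"
      proof -
        obtain l u us where l: "l < m" "l \<noteq> k" "u ^ e = 1"
          and us: "hequiv ts (swp m k l u # swp m k l (a k * u) # us)"
          using IH True * ak by metis
        let ?x = "swp m k l u" and ?y = "swp m k l (a k * u)"
        have x: "?x \<in> swps e m" using l assms(5) by (auto intro: swpsI)
        have y: "?y \<in> swps e m"
          using l assms(5) g'(3)[OF assms(5)] * by (auto intro!: swpsI simp: power_mult_distrib)
        \<comment> \<open>The two edges pass in front of \<open>t\<close> one after the
          other.\<close>
        obtain t' where t': "hequiv (t # ?x # ?y # us) (?x # t' # ?y # us)"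
          using hequiv_back[OF t x, of "[]"] by auto
        have "set (t # ?x # ?y # us) \<subseteq> swps e m"
          using t hequiv_swps[OF us] ts by simp
        then have "t' \<in> swps e m" using hequiv_swps[OF t'] by simp
        then obtain t'' where "hequiv (?x # t' # ?y # us) (?x # ?y # t'' # us)"
          using hequiv_back[OF _ y, of t' "[?x]" us] by auto
        then show ?thesis
          using l hurwitz_equiv.trans[OF hurwitz_equiv_Cons[OF us] hurwitz_equiv.trans[OF t']] by blast
      qed
      then show ?thesis using * by simp
    next
      case (moves_line l w)
      then have *: "p k = l" "a k = w * a' k" using pk_swp True assms(5) by (auto simp: swap_phase_def)
      have "\<exists>us. hequiv (t # ts) (swp m k l (a k) # us)"
      proof (cases "a' k = 1")
        \<comment> \<open>The tail fixes \<open>e_k\<close>, so \<open>t\<close> itself is the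
          required first reflection.\<close>
        case True
        then show ?thesis using moves_line * hurwitz_equiv.refl by auto
      next
        case a'k: False
        obtain l' u us where l': "l' < m" "l' \<noteq> k" and u: "u ^ e = 1"
          and us: "hequiv ts (swp m k l' u # swp m k l' (a' k * u) # us)"
          using IH True a'k by metis
        let ?x = "swp m k l' u" and ?y = "swp m k l' (a' k * u)"
        have x: "?x \<in> swps e m" using l' u assms(5) by (auto intro: swpsI)
        have v: "(a' k * u) ^ e = 1" using u g'(3)[OF assms(5)] by (simp add: power_mult_distrib)
        have y: "?y \<in> swps e m" using l' v assms(5) by (auto intro: swpsI)
        have tus: "hequiv (t # ts) (t # ?x # ?y # us)" using us by (rule hurwitz_equiv_Cons)
        then have red': "reduced (t # ?x # ?y # us)" using hequiv_reduced Cons.prems(1) by blast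
        have "l' \<noteq> l"
        proof
          \<comment> \<open>Three reflections along one edge multiply to a single reflection,
            against reducedness.\<close>
          assume eq: "l' = l"
          have nz: "u \<noteq> 0" "a' k * u \<noteq> 0" using phase_nonzero[OF u] phase_nonzero[OF v] by auto
          have "t * (?x * ?y) = swp m k l (w * a' k)"
            using moves_line l' nz assms(5) by (simp add: eq swp_mult_same swp_mult_phase)
          moreover have "swp m k l (w * a' k) \<in> swps e m"
            using moves_line assms(5) g'(3) by (auto intro!: swpsI simp: power_mult_distrib)
          ultimately have "reduced [t, ?x, ?y]" "prods [t, ?x, ?y] = prods [swp m k l (w * a' k)]"
            "set [swp m k l (w * a' k)] \<subseteq> swps e m"
            using red' reduced_factor[of "[]" "[t, ?x, ?y]" us]
              right_mult_one_mat[OF swp_carrier_mat] by auto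
          then have "length [t, ?x, ?y] \<le> length [swp m k l (w * a' k)]"
            unfolding reduced_def by metis
          then show False by simp
        qed
        \<comment> \<open>Three moves on the triangle \<open>k, l, l'\<close>: conjugation by
          \<open>t\<close> turns \<open>?x\<close> into the edge \<open>?x'\<close> between
          \<open>l\<close> and \<open>l'\<close>, then \<open>?y\<close> passes in front of
          \<open>t\<close>, and conjugation by \<open>?x'\<close> takes its end \<open>l'\<close> to
          \<open>l\<close>.\<close>
        let ?x' = "swp m l l' (u / w)"
        have w: "w \<noteq> 0" "u \<noteq> 0" using moves_line u phase_nonzero by auto
        have uw: "(u / w) ^ e = 1" using u moves_line by (simp add: power_divide)
        have x': "?x' \<in> swps e m" using uw moves_line l' \<open>l' \<noteq> l\<close> by (auto intro: swpsI)
        have "t \<otimes>\<^bsub>GL m\<^esub> ?x \<otimes>\<^bsub>GL m\<^esub> inv\<^bsub>GL m\<^esub> t = ?x'"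
          using conj_swp_swp[of k l w k l' u] moves_line l' u \<open>l' \<noteq> l\<close> assms(5)
          by (simp add: swap_phase_def transpose_def)
        then have 1: "hequiv (t # ?x # ?y # us) (?x' # t # ?y # us)"
          using hequiv_move[OF t x, of "[]" "?y # us"] by simp
        obtain t' where 2: "hequiv (?x' # t # ?y # us) (?x' # ?y # t' # us)"
          using hequiv_back[OF t y, of "[?x']" us] by auto
        have "?x' \<otimes>\<^bsub>GL m\<^esub> ?y \<otimes>\<^bsub>GL m\<^esub> inv\<^bsub>GL m\<^esub> ?x' = swp m k l (a' k * u * inverse (u / w))"
          using conj_swp_swp[of l l' "u / w" k l' "a' k * u"] moves_line l' uw v \<open>l' \<noteq> l\<close> assms(5)
          by (simp add: swap_phase_def transpose_def)
        also have "a' k * u * inverse (u / w) = a k" using * w by simp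
        finally have 3: "hequiv (?x' # ?y # t' # us) (swp m k l (a k) # ?x' # t' # us)"
          using hequiv_move[OF x' y, of "[]" "t' # us"] by simp
        from hurwitz_equiv.trans[OF tus hurwitz_equiv.trans[OF 1 hurwitz_equiv.trans[OF 2 3]]]
        show ?thesis by blast
      qed
      then show ?thesis using * moves_line by simp
    qed
  qed
qed

end

section \<open>Invariant coordinate blocks\<close>

text \<open>The product of the coefficients on an invariant block acts as a determinant without
  signs. It is encoded as a relation because \<open>p\<close> and \<open>a\<close> have to be
  extracted from the matrix.\<close>

definition block_weight :: "nat \<Rightarrow> nat set \<Rightarrow> complex mat \<Rightarrow> complex \<Rightarrow> bool" where
  "block_weight m A g w \<longleftrightarrow>
     (\<exists>p a. g = mon m p a \<and> p permutes {..<m} \<and> (\<forall>i\<in>A. p i \<in> A) \<and> (\<Prod>i\<in>A. a i) = w)"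

lemma block_weight_one: "block_weight m A (1\<^sub>m m) 1"
  unfolding block_weight_def
  by (rule exI[of _ id], rule exI[of _ "\<lambda>_. 1"]) (simp add: mon_id permutes_id)

text \<open>An injective map of a finite block to itself is a bijection, so the coefficients of
  \<open>g\<close> are merely reindexed by \<open>q\<close>.\<close>

lemma block_weight_mult:
  assumes A: "A \<subseteq> {..<m}" and g: "block_weight m A g v" and h: "block_weight m A h w"
  shows "block_weight m A (g * h) (v * w)"
proof -
  obtain p a where g: "g = mon m p a" "p permutes {..<m}" "\<forall>i\<in>A. p i \<in> A" "(\<Prod>i\<in>A. a i) = v"
    using g by (auto simp: block_weight_def)
  obtain q b where h: "h = mon m q b" "q permutes {..<m}" "\<forall>i\<in>A. q i \<in> A" "(\<Prod>i\<in>A. b i) = w"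
    using h by (auto simp: block_weight_def)
  have "inj_on q A" using permutes_inj[OF h(2)] by (rule inj_on_subset) simp
  moreover have "q ` A \<subseteq> A" "finite A" using h(3) A finite_subset by auto
  ultimately have "bij_betw q A A" by (simp add: bij_betw_def endo_inj_surj)
  then have "(\<Prod>i\<in>A. a (q i)) = v"
    using prod.reindex_bij_betw[of q A A a] g(4) by simp
  then show ?thesis
    unfolding block_weight_def using g h mon_mult[OF h(2), of p a b]
    by (intro exI[of _ "p \<circ> q"] exI[of _ "\<lambda>j. a (q j) * b j"])
      (auto simp: prod.distrib intro: permutes_compose)
qed

lemma block_weight_swp:
  assumes "A \<subseteq> {..<m}" "i < m" "j < m" "i \<noteq> j" "u \<noteq> 0" "i \<in> A \<longleftrightarrow> j \<in> A"
  shows "block_weight m A (swp m i j u) 1"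
  unfolding block_weight_def swp_def
  using assms prod_swap_phase[of A i j u] finite_subset[of A "{..<m}"]
  by (intro exI[of _ "transpose i j"] exI[of _ "swap_phase i j u"])
    (auto simp: transpose_permutes_lessThan transpose_def)

lemma block_weight_swp_iff:
  assumes "i < m" "j < m" "i \<noteq> j" "u \<noteq> 0" "block_weight m A (swp m i j u) w"
  shows "i \<in> A \<longleftrightarrow> j \<in> A"
proof -
  obtain p a where p: "swp m i j u = mon m p a" "p permutes {..<m}" "\<forall>i\<in>A. p i \<in> A"
    using assms(5) by (auto simp: block_weight_def)
  have "transpose i j = p"
    by (rule mon_inject(1)[OF p(1)[unfolded swp_def] transpose_permutes_lessThan[OF assms(1,2)] p(2)])
      (use assms(4) in \<open>simp add: swap_phase_def\<close>)
  then show ?thesis using p(3) by auto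
qed

section \<open>Blocks invariant under a list of reflections, and rotation of double edges\<close>

context root_of_unity_swaps
begin

lemma block_weight_prods:
  assumes A: "A \<subseteq> {..<m}"
  shows "\<forall>t\<in>set ts. block_weight m A t 1 \<Longrightarrow> block_weight m A (prods ts) 1"
proof (induction ts)
  case (Cons t ts)
  then show ?case using block_weight_mult[OF A, of t 1 "prods ts" 1] by simp
qed (simp add: block_weight_one)

text \<open>Viewing reflections as edges of a graph: each edge joins at most one new vertex to the
  component of \<open>B\<close>.\<close>

lemma small_invariant_block:
  assumes "set ts \<subseteq> swps e m" "B \<subseteq> {..<m}"
  shows "\<exists>A. B \<subseteq> A \<and> A \<subseteq> {..<m} \<and> card A \<le> card B + length ts \<and>
    (\<forall>t\<in>set ts. block_weight m A t 1)"
  using assms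
proof (induction "length ts" arbitrary: ts B)
  case 0
  then show ?case by auto
next
  case (Suc l)
  show ?case
  proof (cases "\<forall>t\<in>set ts. block_weight m B t 1")
    case True
    then show ?thesis using Suc.prems by (intro exI[of _ B]) auto
  next
    case False
    then obtain t where t: "t \<in> set ts" "\<not> block_weight m B t 1" by blast
    then obtain i j u where s: "t = swp m i j u" and ij: "i < m" "j < m" "i \<noteq> j" and u: "u ^ e = 1"
      using Suc.prems by (blast elim: swpsE)
    have neq: "\<not> (i \<in> B \<longleftrightarrow> j \<in> B)"
      using block_weight_swp[OF Suc.prems(2) ij phase_nonzero[OF u]] t s by blast
    obtain xs ys where ts: "ts = xs @ t # ys" using t split_list by metis
    have "l = length (xs @ ys)" using Suc.hyps(2) ts by simp
    moreover have "insert i (insert j B) \<subseteq> {..<m}" "set (xs @ ys) \<subseteq> swps e m"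
      using Suc.prems ij ts by auto
    ultimately obtain A where A: "insert i (insert j B) \<subseteq> A" "A \<subseteq> {..<m}"
      "card A \<le> card (insert i (insert j B)) + length (xs @ ys)"
      "\<forall>t\<in>set (xs @ ys). block_weight m A t 1"
      using Suc.hyps(1)[of "xs @ ys" "insert i (insert j B)"] by blast
    \<comment> \<open>Exactly one end of the edge lies in \<open>B\<close>, so at most one vertex is
      added; the removal of \<open>t\<close> from the list pays for it.\<close>
    have "card (insert i (insert j B)) \<le> Suc (card B)"
      using neq card_insert_le_m1 by (metis insert_absorb insert_commute card_insert_if finite_insert
          finite_subset finite_lessThan Suc.prems(2) order_refl le_SucI)
    moreover have "block_weight m A t 1"
      unfolding s using A ij u phase_nonzero by (intro block_weight_swp) auto
    ultimately show ?thesis using A ts by (intro exI[of _ A]) auto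
  qed
qed

text \<open>One Hurwitz move turns the phases \<open>(v, w v)\<close> into
  \<open>(v / w, v)\<close>. It divides both by \<open>w\<close>, so \<open>i\<close> moves remove
  the factor \<open>w ^ i\<close>.\<close>

lemma hequiv_rotate:
  assumes kl: "k < m" "l < m" "k \<noteq> l" and u: "u ^ e = 1" and w: "w ^ e = 1"
  shows "hequiv [swp m k l (u * w ^ i), swp m k l (w * (u * w ^ i))]
    [swp m k l u, swp m k l (w * u)]"
proof (induction i)
  case 0
  then show ?case by (simp add: hurwitz_equiv.refl)
next
  case (Suc i)
  let ?u = "u * w ^ i"
  have nz: "u \<noteq> 0" "w \<noteq> 0" using u w phase_nonzero by auto
  have wi: "(w ^ i) ^ e = 1" for i using w by (metis power_commutes power_mult power_one mult.commute)
  have ph: "(u * w ^ i) ^ e = 1" "(w * (w * (u * w ^ i))) ^ e = 1" "(w * (u * w ^ i)) ^ e = 1" for i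
    using u w wi[of i] by (auto simp: power_mult_distrib)
  let ?x = "swp m k l (w * ?u)" and ?y = "swp m k l (w * (w * ?u))"
  have "?x \<otimes>\<^bsub>GL m\<^esub> ?y \<otimes>\<^bsub>GL m\<^esub> inv\<^bsub>GL m\<^esub> ?x = swp m l k (inverse ?u)"
    using conj_swp_swp[of k l "w * ?u" k l "w * (w * ?u)"] kl ph nz
    by (simp add: swap_phase_def field_simps)
  also have "\<dots> = swp m k l ?u" using swp_commute[of k l m ?u] kl by simp
  finally have "hequiv [?x, ?y] [swp m k l ?u, ?x]"
    using hequiv_move[of ?x ?y "[]" "[]"] kl ph by (simp add: swpsI)
  then show ?case using Suc hurwitz_equiv.trans by (simp add: mult_ac) blast
qed

end

section \<open>The Coxeter element\<close>

lemma zeta_eq_cis: "zeta e = cis (2 * pi / real e)"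
  by (simp add: zeta_def cis_conv_exp mult_ac)

lemma zeta_power: "zeta e ^ k = cis (2 * pi * real k / real e)"
  by (simp add: zeta_eq_cis DeMoivre mult.commute)

lemma zeta_power_order: "e \<ge> 1 \<Longrightarrow> zeta e ^ e = 1"
  by (simp add: zeta_power)

lemma root_of_unity_zeta_power:
  assumes "e \<ge> 1" "z ^ e = 1"
  shows "\<exists>k. z = zeta e ^ k"
  using bij_betw_roots_unity[of e] assms unfolding zeta_power bij_betw_def by auto

text \<open>Together with \<open>cox_phase\<close> this interpolates between a diagonal element, at
  \<open>k = n\<close>, and \<open>c\<close>, at \<open>k = 1\<close>. Indices go down because
  column \<open>j\<close> of \<open>c\<close> has its entry in row \<open>j - 1\<close>.\<close>

definition cox_perm :: "nat \<Rightarrow> nat \<Rightarrow> nat \<Rightarrow> nat" where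
  "cox_perm n k j = (if j = k then n else if k < j \<and> j \<le> n then j - 1 else j)"

definition cox_phase :: "nat \<Rightarrow> nat \<Rightarrow> nat \<Rightarrow> complex" where
  "cox_phase e k j = (if j = 0 then inverse (zeta e) else if j = k then zeta e else 1)"

lemma cox_eq_mon:
  assumes "n \<ge> 1"
  shows "cox e n = mon (Suc n) (cox_perm n 1) (cox_phase e 1)"
  using assms by (intro eq_matI) (auto simp: cox_def mon_def cox_perm_def cox_phase_def)

lemma cox_perm_permutes:
  assumes "k \<le> n"
  shows "cox_perm n k permutes {..<Suc n}"
proof (rule bij_imp_permutes)
  show "bij_betw (cox_perm n k) {..<Suc n} {..<Suc n}"
    using assms
    by (intro bij_betw_byWitness[where f' = "\<lambda>i. if i = n then k else if k \<le> i \<and> i < n then Suc i else i"])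
      (auto simp: cox_perm_def)
qed (use assms in \<open>auto simp: cox_perm_def\<close>)

section \<open>Reduced decompositions of the Coxeter element and of its factors\<close>

locale coxeter_swaps = root_of_unity_swaps e "Suc n" for e n +
  assumes n: "n \<ge> 1"
begin

lemma zeta_nonzero: "zeta e \<noteq> 0"
  using phase_nonzero zeta_power_order[OF e] by blast

text \<open>Descending induction: a double edge between \<open>0\<close> and \<open>n\<close> gives
  the diagonal element, and each further transposition of \<open>k\<close> and \<open>k + 1\<close>
  on the right lengthens the cycle. At \<open>k = 1\<close> there are \<open>n + 1\<close>
  reflections.\<close>

lemma cox_decomposition:
  assumes "1 \<le> k" "k \<le> n"
  shows "\<exists>ts. set ts \<subseteq> swps e (Suc n) \<and> length ts = n - k + 2 \<and>
    prods ts = mon (Suc n) (cox_perm n k) (cox_phase e k)"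
  using assms(2,1)
proof (induction k rule: inc_induct)
  case base
  let ?x = "swp (Suc n) 0 n (zeta e)" and ?y = "swp (Suc n) 0 n 1"
  have "?x * ?y = mon (Suc n) id (swap_phase 0 n (inverse (zeta e)))"
    using n zeta_nonzero by (simp add: swp_mult_same divide_inverse)
  also have "\<dots> = mon (Suc n) (cox_perm n n) (cox_phase e n)"
    using n by (intro mon_cong) (auto simp: swap_phase_def cox_perm_def cox_phase_def)
  finally have "prods [?x, ?y] = mon (Suc n) (cox_perm n n) (cox_phase e n)"
    by (simp add: right_mult_one_mat[OF swp_carrier_mat])
  moreover have "?x \<in> swps e (Suc n)" "?y \<in> swps e (Suc n)"
    using n zeta_power_order[OF e] by (auto intro!: swpsI)
  ultimately show ?case by (intro exI[of _ "[?x, ?y]"]) simp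
next
  case (step k)
  then obtain ts where ts: "set ts \<subseteq> swps e (Suc n)" "length ts = n - Suc k + 2"
    "prods ts = mon (Suc n) (cox_perm n (Suc k)) (cox_phase e (Suc k))" by auto
  let ?s = "swp (Suc n) k (Suc k) 1"
  have s: "?s \<in> swps e (Suc n)" using step by (auto intro!: swpsI)
  have "prods (ts @ [?s]) = prods ts * ?s"
    using prods_append[OF ts(1), of "[?s]"] s by (simp add: right_mult_one_mat[OF swp_carrier_mat])
  also have "\<dots> = mon (Suc n) (cox_perm n k) (cox_phase e k)"
    unfolding ts(3) swp_def using step
    by (subst mon_mult[OF transpose_permutes_lessThan], simp, simp, intro mon_cong)
      (auto simp: cox_perm_def cox_phase_def swap_phase_def transpose_def)
  finally show ?case using ts s step by (intro exI[of _ "ts @ [?s]"]) auto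
qed

lemma reduced_cox_length:
  assumes "reduced ts" "prods ts = cox e n"
  shows "length ts \<le> Suc n"
proof -
  obtain us where "set us \<subseteq> swps e (Suc n)" "length us = n - 1 + 2" "prods us = cox e n"
    using cox_decomposition[of 1] n cox_eq_mon[OF n] by auto
  then show ?thesis using assms n unfolding reduced_def by fastforce
qed

text \<open>The orbits of the permutation of \<open>c\<close> are \<open>{0}\<close> and
  \<open>{1..n}\<close>, so these are the only proper nonempty invariant blocks; their weights are
  \<open>inverse (zeta e)\<close> and \<open>zeta e\<close>.\<close>

lemma cox_block_weight:
  assumes A: "A \<subseteq> {..<Suc n}" "A \<noteq> {}" "A \<noteq> {..<Suc n}"
    and w: "block_weight (Suc n) A (cox e n) w"
  shows "w = zeta e \<or> w = inverse (zeta e)"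
proof -
  obtain p a where p: "cox e n = mon (Suc n) p a" "p permutes {..<Suc n}" "\<forall>i\<in>A. p i \<in> A"
    "(\<Prod>i\<in>A. a i) = w"
    using w by (auto simp: block_weight_def)
  have eq: "mon (Suc n) (cox_perm n 1) (cox_phase e 1) = mon (Suc n) p a"
    using p(1) cox_eq_mon[OF n] by simp
  have nz: "cox_phase e 1 j \<noteq> 0" for j using zeta_nonzero by (simp add: cox_phase_def)
  have "cox_perm n 1 = p" "\<And>j. j < Suc n \<Longrightarrow> cox_phase e 1 j = a j"
    using mon_inject[OF eq cox_perm_permutes[OF n] p(2) nz] by auto
  then have stable: "\<And>i. i \<in> A \<Longrightarrow> cox_perm n 1 i \<in> A" and weight: "(\<Prod>i\<in>A. cox_phase e 1 i) = w"
    using p(3,4) A(1) by (auto intro: prod.cong)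
  \<comment> \<open>Each \<open>j > 1\<close> goes to \<open>j - 1\<close>, so an invariant block
    that meets \<open>{1..n}\<close> contains \<open>1\<close>.\<close>
  have down: "j \<in> A \<Longrightarrow> 1 \<le> j \<Longrightarrow> 1 \<in> A" for j
  proof (induction j)
    case (Suc j)
    show ?case
    proof (cases "j = 0")
      case False
      then have "j \<in> A" using stable[OF Suc.prems(1)] A(1) Suc.prems by (auto simp: cox_perm_def)
      then show ?thesis using Suc.IH False by simp
    qed (use Suc.prems in simp)
  qed simp
  have all: "{1..n} \<subseteq> A" if "1 \<in> A"
  proof
    \<comment> \<open>From \<open>1\<close> the cycle jumps to \<open>n\<close> and then
      descends.\<close>
    have sub: "n - i \<in> A" if "i < n" for i
      using that
    proof (induction i)
      case 0
      then show ?case using stable[OF \<open>1 \<in> A\<close>] by (simp add: cox_perm_def)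
    next
      case (Suc i)
      then show ?case using stable[of "n - i"] by (auto simp: cox_perm_def split: if_splits)
    qed
    show "j \<in> A" if "j \<in> {1..n}" for j
      using that sub[of "n - j"] by simp
  qed
  have range: "{..<Suc n} = insert 0 {1..n}" by auto
  show ?thesis
  proof (cases "1 \<in> A")
    case True
    then have sub: "{1..n} \<subseteq> A" by (rule all)
    have "0 \<notin> A" using sub A(1,3) unfolding range by (metis insert_subset subset_antisym)
    then have "A = {1..n}" using sub A(1) unfolding range by (metis subset_antisym subset_insert)
    then have "w = (\<Prod>i\<in>{1..n}. cox_phase e 1 i)" using weight by simp
    also have "\<dots> = (\<Prod>i\<in>{1}. cox_phase e 1 i)"
      using n by (intro prod.mono_neutral_right) (auto simp: cox_phase_def)
    finally show ?thesis by (simp add: cox_phase_def)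
  next
    case False
    then have "\<not> 1 \<le> j" if "j \<in> A" for j using that down by blast
    then have "A \<subseteq> {0}" by fastforce
    then have "A = {0}" using A(2) by blast
    then show ?thesis using weight by (simp add: cox_phase_def)
  qed
qed

text \<open>A decomposition of \<open>c\<close> has at most \<open>n + 1\<close> edges and no component of weight one other than
  all of \<open>{0..n}\<close>. Each diagonal factor costs a double edge, so there is room for only one of them.\<close>

lemma diagonal_factor:
  assumes red: "reduced (us @ swp (Suc n) k l u # swp (Suc n) k l (w * u) # rs @ vs)"
    (is "reduced (us @ ?x # ?y # rs @ vs)")
    and cox: "prods (us @ swp (Suc n) k l u # swp (Suc n) k l (w * u) # rs @ vs) = cox e n"
    and kl: "k < Suc n" "l < Suc n" "k \<noteq> l" and u: "u ^ e = 1" and w: "w ^ e = 1" "w \<noteq> 1"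
    and rs: "prods rs = mon (Suc n) id b" "\<And>i. i < Suc n \<Longrightarrow> b i \<noteq> 0"
  shows "rs = [] \<and> (w = zeta e \<or> w = inverse (zeta e))"
proof
  let ?m = "Suc n"
  have wu: "(w * u) ^ e = 1" using u w by (simp add: power_mult_distrib)
  have nz: "u \<noteq> 0" "w * u \<noteq> 0" "w \<noteq> 0"
    using phase_nonzero[OF u] phase_nonzero[OF w(1)] by auto
  \<comment> \<open>If \<open>zeta e\<close> were one, no \<open>e\<close>-th root of unity other
    than one would exist, against \<open>w\<close>.\<close>
  have zeta: "zeta e \<noteq> 1" using root_of_unity_zeta_power[OF e w(1)] w(2) by auto
  have sw: "set us \<subseteq> swps e ?m" "?x \<in> swps e ?m" "?y \<in> swps e ?m" "set rs \<subseteq> swps e ?m"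
    "set vs \<subseteq> swps e ?m" using red by (auto simp: reduced_def)
  \<comment> \<open>The pair \<open>?x\<close>, \<open>?y\<close> takes up two of at most
    \<open>n + 1\<close> reflections.\<close>
  have len: "length us + (length rs + length vs) < n"
    using reduced_cox_length[OF red cox] by simp
  have no_block: "A = {} \<or> A = {..<?m}" if "A \<subseteq> {..<?m}" "block_weight ?m A (cox e n) 1" for A
    using cox_block_weight[OF that(1) _ _ that(2)] zeta by (metis inverse_1 inverse_eq_iff_eq)
  have red_rs: "reduced rs"
    using reduced_factor[of "us @ [?x, ?y]" rs vs] red by simp
  show rs_Nil: "rs = []"
  proof (cases "\<forall>i<?m. b i = 1")
    case True
    then have "mon ?m id b = mon ?m id (\<lambda>_. 1)" by (intro mon_cong) auto
    then have "prods rs = prods []" using rs(1) by (simp add: mon_id)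
    then show ?thesis using red_rs unfolding reduced_def by (metis empty_set empty_subsetI le_zero_eq
          length_0_conv list.size(3))
  next
    case False
    then obtain k' where k': "k' < ?m" "b k' \<noteq> 1" by blast
    obtain l' u' rs' where l': "l' < ?m" "l' \<noteq> k'" "u' ^ e = 1"
      and eq: "hequiv rs (swp ?m k' l' u' # swp ?m k' l' (b k' * u') # rs')"
        (is "hequiv rs (?x' # ?y' # rs')")
      using straighten[OF red_rs rs(1) permutes_id rs(2) k'(1)] k' by auto
    have sw': "?x' \<in> swps e ?m" "?y' \<in> swps e ?m" "set rs' \<subseteq> swps e ?m"
      using hequiv_swps[OF eq] sw by auto
    have b: "b k' * u' \<noteq> 0" using rs(2)[OF k'(1)] phase_nonzero[OF l'(3)] by simp
    \<comment> \<open>One reflection is kept from each of the two double edges. Fewer than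
      \<open>n\<close> edges remain, so some proper block around \<open>0\<close> is invariant; the
      omitted \<open>?y\<close> and \<open>?y'\<close> have the same ends as \<open>?x\<close> and
      \<open>?x'\<close> and preserve it too.\<close>
    let ?L = "us @ ?x # ?x' # rs' @ vs"
    have "length rs = Suc (Suc (length rs'))" using hurwitz_equiv_length[OF eq] by simp
    then have "length ?L < n" using len by simp
    moreover obtain A where A: "{0} \<subseteq> A" "A \<subseteq> {..<?m}" "card A \<le> card {0::nat} + length ?L"
      "\<forall>t\<in>set ?L. block_weight ?m A t 1"
      using small_invariant_block[of ?L "{0}"] sw sw' by auto
    ultimately have card: "card A \<noteq> card {..<?m}" by simp
    have "block_weight ?m A ?y 1" "block_weight ?m A ?y' 1"
      using block_weight_swp_iff[OF kl nz(1), of A 1] block_weight_swp[OF A(2) kl nz(2)]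
        block_weight_swp_iff[OF k'(1) l'(1) l'(2)[symmetric] phase_nonzero[OF l'(3)], of A 1]
        block_weight_swp[OF A(2) k'(1) l'(1) l'(2)[symmetric] b] A(4)
      by auto
    then have "block_weight ?m A (prods (us @ [?x, ?y] @ (?x' # ?y' # rs') @ vs)) 1"
      using A by (intro block_weight_prods) auto
    moreover have "prods (us @ [?x, ?y] @ (?x' # ?y' # rs') @ vs) = cox e n"
      using prods_factor[of "us @ [?x, ?y]" rs "?x' # ?y' # rs'" vs] sw sw' cox hequiv_prods[OF eq]
      by simp
    ultimately show ?thesis using no_block[OF A(2)] A(1) card by auto
  qed
  \<comment> \<open>Now both \<open>?x\<close> and \<open>?y\<close> are omitted; fewer than
    \<open>n\<close> edges leave a proper invariant block around \<open>k\<close>.\<close>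
  obtain A where A: "{k} \<subseteq> A" "A \<subseteq> {..<?m}" "card A \<le> card {k} + length (us @ vs)"
    "\<forall>t\<in>set (us @ vs). block_weight ?m A t 1"
    using small_invariant_block[of "us @ vs" "{k}"] sw kl by auto
  have proper: "A \<noteq> {}" "A \<noteq> {..<?m}" using A len by auto
  have "l \<notin> A"
  proof
    assume "l \<in> A"
    then have "block_weight ?m A ?x 1" "block_weight ?m A ?y 1"
      using A kl nz by (auto intro!: block_weight_swp)
    then have "block_weight ?m A (cox e n) 1"
      using A unfolding cox[symmetric] rs_Nil by (intro block_weight_prods) auto
    then show False using no_block[OF A(2)] proper by blast
  qed
  \<comment> \<open>Since \<open>A\<close> contains \<open>k\<close> but not \<open>l\<close>, the
    pair contributes exactly \<open>w\<close> to the weight of \<open>c\<close> on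
    \<open>A\<close>.\<close>
  have "(\<Prod>i\<in>A. swap_phase k l w i) = (\<Prod>i\<in>{k}. swap_phase k l w i)"
    using A \<open>l \<notin> A\<close> finite_subset[OF A(2)]
    by (intro prod.mono_neutral_right) (auto simp: swap_phase_def)
  then have "block_weight ?m A (?x * ?y) w"
    unfolding swp_mult_same[OF kl nz(1,2)] block_weight_def
    using nz by (intro exI[of _ id] exI[of _ "swap_phase k l w"])
      (auto simp: permutes_id swap_phase_def)
  moreover have "block_weight ?m A (prods us) 1" "block_weight ?m A (prods vs) 1"
    using A by (auto intro!: block_weight_prods)
  ultimately have "block_weight ?m A (prods us * (?x * ?y * prods vs)) (1 * (w * 1))"
    using A(2) by (intro block_weight_mult)
  moreover have "prods us * (?x * ?y * prods vs) = cox e n"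
    using prods_append[of us "?x # ?y # vs"] sw cox
      assoc_mult_mat[OF swp_carrier_mat swp_carrier_mat GL_carrier_mat[OF prods_carrier[OF sw(5)]]]
    by (simp add: rs_Nil)
  ultimately show "w = zeta e \<or> w = inverse (zeta e)"
    using cox_block_weight[OF A(2) proper] by simp
qed

text \<open>The context \<open>us\<close>, \<open>vs\<close> keeps the induction inside
  decompositions of \<open>c\<close>: a split-off first reflection joins \<open>us\<close>, and the
  length bound for \<open>c\<close> remains available. The competitor \<open>ts'\<close> needs no
  such context.\<close>

lemma hurwitz_transitive_factor:
  assumes "reduced (us @ ts @ vs)" "prods (us @ ts @ vs) = cox e n"
    "reduced ts'" "prods ts' = prods ts"
  shows "hequiv ts ts'"
  using assms
proof (induction "length ts" arbitrary: us ts ts' rule: less_induct)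
  case less
  let ?m = "Suc n"
  note red = less.prems(1) and cox = less.prems(2) and red' = less.prems(3) and eq = less.prems(4)
  have red_ts: "reduced ts" using reduced_factor red by blast
  have sw: "set us \<subseteq> swps e ?m" "set ts \<subseteq> swps e ?m" "set vs \<subseteq> swps e ?m"
    using red by (auto simp: reduced_def)
  have sw': "set ts' \<subseteq> swps e ?m" using red' by (simp add: reduced_def)
  have len: "length ts' = length ts"
    using red_ts red' eq by (auto simp: reduced_def intro: antisym)
  obtain p a where g: "prods ts = mon ?m p a" "p permutes {..<?m}" "\<And>i. i < ?m \<Longrightarrow> a i ^ e = 1"
    using prods_monomials[OF sw(2)] by (rule monomialsE) blast
  have g': "prods ts' = mon ?m p a" using g eq by simp
  have a: "\<And>i. i < ?m \<Longrightarrow> a i \<noteq> 0" using g(3) phase_nonzero by blast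
  have cox_hequiv: "reduced (us @ xs @ vs) \<and> prods (us @ xs @ vs) = cox e n" if "hequiv ts xs" for xs
    using hurwitz_equiv_append[OF that, of us vs] red cox hequiv_reduced hequiv_prods
    by (metis reduced_def)
  show ?case
  proof (cases "\<exists>k<?m. p k \<noteq> k")
    case True
    then obtain k where k: "k < ?m" "p k \<noteq> k" by blast
    \<comment> \<open>\<open>?s\<close> depends only on the common product, so both lists can be
      made to start with it and it cancels.\<close>
    let ?s = "swp ?m k (p k) (a k)"
    obtain xs where xs: "hequiv ts (?s # xs)"
      using straighten[OF red_ts g(1,2) a k(1)] k by auto
    obtain xs' where xs': "hequiv ts' (?s # xs')"
      using straighten[OF red' g' g(2) a k(1)] k by auto
    have s: "?s \<in> swps e ?m" "set xs \<subseteq> swps e ?m" "set xs' \<subseteq> swps e ?m"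
      using hequiv_swps[OF xs] hequiv_swps[OF xs'] sw sw' by auto
    have "?s \<otimes>\<^bsub>GL ?m\<^esub> prods xs = ?s \<otimes>\<^bsub>GL ?m\<^esub> prods xs'"
      using hequiv_prods[OF xs sw(2)] hequiv_prods[OF xs' sw'] eq by simp
    then have "prods xs' = prods xs"
      using G.Units_l_cancel[of ?s "prods xs'" "prods xs"] s swps_carrier prods_carrier
      by (auto simp: G.Units_eq)
    moreover have "reduced xs'"
      using hequiv_reduced[OF xs' red'] reduced_factor[of "[?s]" xs' "[]"] by simp
    moreover have "length xs < length ts" using hurwitz_equiv_length[OF xs] by simp
    ultimately have "hequiv xs xs'"
      using less.hyps[of xs "us @ [?s]" xs'] cox_hequiv[OF xs] by simp
    then show ?thesis
      using xs xs' hurwitz_equiv_Cons hurwitz_equiv.trans hurwitz_equiv.sym by meson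
  next
    case False
    then have id: "p = id" using g(2) by (auto simp: permutes_def fun_eq_iff)
    show ?thesis
    proof (cases "\<exists>k<?m. a k \<noteq> 1")
      case False
      then have "mon ?m p a = mon ?m id (\<lambda>_. 1)" by (intro mon_cong) (auto simp: id)
      then have "prods [] = prods ts" using g(1) by (simp add: mon_id)
      then have "length ts \<le> length ([] :: complex mat list)"
        using red_ts unfolding reduced_def by (metis empty_set empty_subsetI)
      then show ?thesis using len by (simp add: hurwitz_equiv.refl)
    next
      case True
      then obtain k where k: "k < ?m" "a k \<noteq> 1" by blast
      have pk: "p k = k" by (simp add: id)
      obtain l u xs where l: "l < ?m" "l \<noteq> k" "u ^ e = 1"
        and xs: "hequiv ts (swp ?m k l u # swp ?m k l (a k * u) # xs)"
        using straighten[OF red_ts g(1,2) a k(1)] k pk by auto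
      obtain l' u' xs' where l': "l' < ?m" "l' \<noteq> k" "u' ^ e = 1"
        and xs': "hequiv ts' (swp ?m k l' u' # swp ?m k l' (a k * u') # xs')"
        using straighten[OF red' g' g(2) a k(1)] k pk by auto
      let ?x = "swp ?m k l u" and ?y = "swp ?m k l (a k * u)"
      let ?x' = "swp ?m k l' u'" and ?y' = "swp ?m k l' (a k * u')"
      have nz: "u \<noteq> 0" "a k * u \<noteq> 0" "u' \<noteq> 0" "a k * u' \<noteq> 0" "a k \<noteq> 0"
        using phase_nonzero[OF l(3)] phase_nonzero[OF l'(3)] a[OF k(1)] by auto
      have sxs: "set xs \<subseteq> swps e ?m" using hequiv_swps[OF xs] sw by simp
      have xy: "?x * ?y = mon ?m id (swap_phase k l (a k))"
        "?x' * ?y' = mon ?m id (swap_phase k l' (a k))"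
        using swp_mult_same[of k ?m l u "a k * u"] swp_mult_same[of k ?m l' u' "a k * u'"] k l l' nz
        by auto
      have prod_xs: "prods ts = ?x * ?y * prods xs"
        using hequiv_prods[OF xs sw(2)]
          assoc_mult_mat[OF swp_carrier_mat swp_carrier_mat GL_carrier_mat[OF prods_carrier[OF sxs]]]
        by simp
      obtain q b where q: "prods xs = mon ?m q b" "q permutes {..<?m}" "\<And>i. i < ?m \<Longrightarrow> b i ^ e = 1"
        using prods_monomials[OF sxs] by (rule monomialsE) blast
      have "mon ?m p a = mon ?m (id \<circ> q) (\<lambda>j. swap_phase k l (a k) (q j) * b j)"
        using prod_xs g(1) xy(1) q(1) mon_mult[OF q(2), of id "swap_phase k l (a k)" b] by simp
      then have "p = id \<circ> q"
        using g(2) q(2) a by (intro mon_inject(1)[of ?m p a]) auto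
      then have "prods xs = mon ?m id b" using q id by simp
      moreover have "\<And>i. i < ?m \<Longrightarrow> b i \<noteq> 0" using q(3) phase_nonzero by blast
      \<comment> \<open>The remainder \<open>xs\<close> is diagonal as well, hence empty: both lists
        are reduced to a pair.\<close>
      ultimately have *: "xs = [] \<and> (a k = zeta e \<or> a k = inverse (zeta e))"
        using diagonal_factor[of us k l u "a k" xs vs b] cox_hequiv[OF xs] k l g(3) by simp
      then have "xs' = []"
        using hurwitz_equiv_length[OF xs] hurwitz_equiv_length[OF xs'] len by simp
      have "l' = l"
      proof (rule ccontr)
        assume ne: "l' \<noteq> l"
        have "?x * ?y = ?x' * ?y'"
          using hequiv_prods[OF xs sw(2)] hequiv_prods[OF xs' sw'] eq * \<open>xs' = []\<close>
          by (simp add: right_mult_one_mat[OF swp_carrier_mat])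
        then have eq': "mon ?m id (swap_phase k l (a k)) = mon ?m id (swap_phase k l' (a k))"
          using xy by simp
        \<comment> \<open>The entry at \<open>l\<close> is \<open>inverse (a k)\<close> on the left
          but one on the right.\<close>
        have "swap_phase k l (a k) l = swap_phase k l' (a k) l"
          using nz l by (intro mon_unit_vector(2)[OF eq' permutes_id permutes_id])
            (auto simp: swap_phase_def)
        then show False using l ne k by (simp add: swap_phase_def)
      qed
      have "hequiv [?x, ?y] [?x', ?y']"
      proof -
        have ae: "a k ^ e = 1" using g(3) k by simp
        \<comment> \<open>The ratio of \<open>u'\<close> and \<open>u\<close> is a power of
          \<open>zeta e\<close>, hence of \<open>a k\<close> or its inverse. The disjunction allows
          the rotation to start from either pair.\<close>
        have "\<exists>i. u' = u * a k ^ i \<or> u = u' * a k ^ i"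
        proof -
          have "(u' / u) ^ e = 1" "(u / u') ^ e = 1" using l l' by (simp_all add: power_divide)
          then obtain i j where "u' / u = zeta e ^ i" "u / u' = zeta e ^ j"
            using root_of_unity_zeta_power[OF e] by metis
          then have "u' = u * zeta e ^ i" "u = u' * zeta e ^ j" using nz by (auto simp: field_simps)
          then show ?thesis using * zeta_nonzero
            by (metis (no_types, lifting) nonzero_mult_div_cancel_right power_inverse
                divide_inverse power_not_zero)
        qed
        then show ?thesis
          using hequiv_rotate[OF k(1) l(1) l(2)[symmetric] l(3) ae]
            hequiv_rotate[OF k(1) l(1) l(2)[symmetric] l'(3) ae] \<open>l' = l\<close> hurwitz_equiv.sym
          by metis
      qed
      then show ?thesis
        using xs xs' * \<open>xs' = []\<close> hurwitz_equiv.trans hurwitz_equiv.sym by metis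
    qed
  qed
qed

end

section \<open>Transitivity of the Hurwitz action\<close>

lemma list_prod_eq: "list_prod n = prod_list_in (GL (Suc n))"
  by (simp add: fun_eq_iff list_prod_def prod_list_in_def)

theorem proposition6p1:
  fixes e n :: nat and g :: "complex mat"
  assumes "e \<ge> 1" and "n \<ge> 1" and "g \<in> P_G e n"
  shows "transitive_action (braid_group (l_T e n g)) (Red_T e n g) (hurwitz_action e n g)"
proof -
  interpret coxeter_swaps e n by unfold_locales (use assms in auto)
  have Red: "Red_T e n h = {ts. reduced ts \<and> prods ts = h}" for h
    by (auto simp: Red_T_def decomps_def reduced_def reflections_eq_swps[OF assms(1)] list_prod_eq)
  obtain ws l where ws: "reduced ws" "prods ws = cox e n" and g: "g = prods (take l ws)"
    using assms(3) by (auto simp: P_G_def prefix_T_def Red list_prod_eq)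
  define ts where "ts = take l ws"
  \<comment> \<open>A prefix of a reduced decomposition of \<open>c\<close> is a factor with empty
    left context.\<close>
  have split: "[] @ ts @ drop l ws = ws" by (simp add: ts_def)
  have red: "reduced ts" using reduced_factor[of "[]" ts "drop l ws"] ws split by simp
  have hequiv_ts: "hequiv ts us" if "us \<in> Red_T e n g" for us
    using hurwitz_transitive_factor[of "[]" ts "drop l ws" us] ws split that g
    by (simp add: Red ts_def)
  have length: "l_T e n g = length ts"
    unfolding l_T_def
  proof (rule the_equality)
    show "\<exists>us\<in>Red_T e n g. length us = length ts" using red g by (auto simp: Red ts_def)
    show "k = length ts" if "\<exists>us\<in>Red_T e n g. length us = k" for k
      using that hequiv_ts hurwitz_equiv_length by force
  qed
  interpret hurwitz_closed "GL (Suc n)" "Red_T e n g" "length ts"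
  proof unfold_locales
    show "length us = length ts" if "us \<in> Red_T e n g" for us
      using hurwitz_equiv_length[OF hequiv_ts[OF that]] by simp
    show "set us \<subseteq> carrier (GL (Suc n))" if "us \<in> Red_T e n g" for us
      using that set_swps_carrier by (auto simp: Red reduced_def)
    show "vs \<in> Red_T e n g" if "us \<in> Red_T e n g" "hequiv us vs" for us vs
      using that hequiv_reduced[OF that(2)] hequiv_prods[OF that(2)] by (auto simp: Red reduced_def)
  qed
  \<comment> \<open>Any two reduced decompositions of \<open>g\<close> are joined through
    \<open>ts\<close>.\<close>
  have "transitive_action (braid_group (length ts)) (Red_T e n g)
    (\<lambda>\<beta>. the_elem (word_eval (BijGroup (Red_T e n g))
      (\<lambda>i. restrict (hurwitz_move (GL (Suc n)) i) (Red_T e n g)) ` \<beta>))"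
    by (rule transitive_action_hurwitz)
      (rule hurwitz_equiv.trans[OF hurwitz_equiv.sym[OF hequiv_ts] hequiv_ts])
  then show ?thesis
    by (simp add: length hurwitz_action_def[abs_def] hurwitz_sigma_eq_hurwitz_move)
qed

end
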